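(* Let $G=(V,E)$ be a connected, infinite, locally finite, vertex-transitive graph whose vertices are (distinct) vectors in a Euclidean space $\mathbb{R}^k$, and consider the noisy cascade observation model on $G$ with random source $v_0$ described in the context. Suppose that the prior distribution of $v_0$ has finite variance, i.e. $\mathbb{E}\|v_0\|_2^2<\infty$. Let $\hat v(t)=\mathbb{E}[v_0\mid\mathcal{F}_t]$ be the conditional mean estimator. For $s\ge 0$ let $\mathcal{T}_s$ be the set of stopping times $T$ with $T\ge s$ almost surely, and for $T\in\mathcal{T}_s$ define $$f_s(T):=\|\hat v(T)-\hat v(s)\|_2^2-\big(|\mathcal{N}(T)|-|\mathcal{N}(s)|\big).$$ Then the stopping time $$T_{opt}:=\min\Big\{s\ge 0:\ \operatorname*{ess\,sup}_{T\in\mathcal{T}_s}\mathbb{E}[f_s(T)\mid\mathcal{F}_s]=0\Big\}$$ is optimal for the problem $$\min_{T,\tilde v}\ \mathbb{E}\big[\|v_0-\tilde v(T)\|_2^2+|\mathcal{N}_{v_0}(T)|\big],$$ where the minimum is over all stopping times $T$ and all sequences $\tilde v=\{\tilde v(t)\}_{t\ge 0}$ of $\mathbb{R}^k$-valued estimators with $\tilde v(t)$ being $\mathcal{F}_t$-measurable; that is, the minimum is attained by $(T_{opt},\hat v)$.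
   Context: Model. Time is indexed by integers $t\ge 0$. $d(\cdot,\cdot)$ is the shortest-path distance in $G$. For a vertex $v$, $\mathcal{N}_v(t)=\{u\in V: d(u,v)\le t\}$. By vertex-transitivity $|\mathcal{N}_v(t)|$ does not depend on $v$ and is written $|\mathcal{N}(t)|$. $Q_0,Q_1$ are mutually absolutely continuous probability measures on a common measurable space. The source $v_0$ is a random element of $V$ (its law is called the prior). Conditionally on $v_0$, the signals $y_u(t)$ ($u\in V$, $t\ge 0$) are independent over time and over vertices, with $y_u(t)\sim Q_1$ if $d(u,v_0)\le t$ and $y_u(t)\sim Q_0$ if $d(u,v_0)>t$. The filtration is $\mathcal{F}_t=\sigma(y(0),\dots,y(t))$, where $y(t)=\{y_u(t)\}_{u\in V}$. Stopping times are with respect to $\{\mathcal{F}_t\}_{t\ge0}$ and almost surely finite (stopping at time $\infty$ would incur infinite cost since $|\mathcal{N}(t)|\to\infty$). Conditional expectations $\mathbb{E}[f_s(T)\mid\mathcal{F}_s]$ take values in $[-\infty,\infty)$. *)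

theory Defs
  imports "HOL-Probability.Probability"
begin

definition graph_dist :: "('v \<times> 'v) set \<Rightarrow> 'v \<Rightarrow> 'v \<Rightarrow> nat" where
  "graph_dist E u v = (LEAST n. (u, v) \<in> E ^^ n)"

definition nbhd :: "'v set \<Rightarrow> ('v \<times> 'v) set \<Rightarrow> 'v \<Rightarrow> nat \<Rightarrow> 'v set" where
  "nbhd V E v t = {u \<in> V. graph_dist E u v \<le> t}"

(* Well defined on vertex-transitive graphs, where all balls of radius t have the same size. *)
definition nbhd_size :: "'v set \<Rightarrow> ('v \<times> 'v) set \<Rightarrow> nat \<Rightarrow> nat" where
  "nbhd_size V E t = (THE n. \<forall>v\<in>V. card (nbhd V E v t) = n)"

definition graph_automorphism :: "'v set \<Rightarrow> ('v \<times> 'v) set \<Rightarrow> ('v \<Rightarrow> 'v) \<Rightarrow> bool" where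
  "graph_automorphism V E \<phi> \<longleftrightarrow>
     bij_betw \<phi> V V \<and> (\<forall>x\<in>V. \<forall>y\<in>V. (\<phi> x, \<phi> y) \<in> E \<longleftrightarrow> (x, y) \<in> E)"

locale transitive_graph =
  fixes V :: "'v set" and E :: "('v \<times> 'v) set"
  assumes edges: "E \<subseteq> V \<times> V"
    and sym_edges: "sym E"
    and no_loops: "irrefl E"
    and connected: "\<And>u v. u \<in> V \<Longrightarrow> v \<in> V \<Longrightarrow> (u, v) \<in> E\<^sup>*"
    and infinite_vertices: "infinite V"
    and locally_finite: "\<And>v. v \<in> V \<Longrightarrow> finite (E `` {v})"
    and vertex_transitive:
      "\<And>u v. u \<in> V \<Longrightarrow> v \<in> V \<Longrightarrow> \<exists>\<phi>. graph_automorphism V E \<phi> \<and> \<phi> u = v"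

(* The source takes values in the countable set V, so conditioning on it means conditioning on
   the events {v0 = v} of positive probability. *)
locale noisy_cascade = transitive_graph V E + prob_space M + Q0: prob_space Q0 + Q1: prob_space Q1
  for V :: "(real ^ 'k) set" and E :: "((real ^ 'k) \<times> (real ^ 'k)) set"
    and M :: "'w measure" and Q0 Q1 :: "'s measure" +
  fixes v0 :: "'w \<Rightarrow> real ^ 'k" and y :: "real ^ 'k \<Rightarrow> nat \<Rightarrow> 'w \<Rightarrow> 's"
  assumes sets_Q: "sets Q1 = sets Q0"
    and ac_Q: "absolutely_continuous Q0 Q1" "absolutely_continuous Q1 Q0"
    and source: "v0 \<in> measurable M (count_space V)"
    and signal: "\<And>u t. u \<in> V \<Longrightarrow> y u t \<in> measurable M Q0"
    and signals_cond_indep: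
      "\<And>v. v \<in> V \<Longrightarrow> measure M {\<omega> \<in> space M. v0 \<omega> = v} > 0 \<Longrightarrow>
         prob_space.indep_vars (uniform_measure M {\<omega> \<in> space M. v0 \<omega> = v})
           (\<lambda>_. Q0) (\<lambda>(u, t). y u t) (V \<times> UNIV)"
    and signal_cond_law:
      "\<And>v u t. v \<in> V \<Longrightarrow> measure M {\<omega> \<in> space M. v0 \<omega> = v} > 0 \<Longrightarrow> u \<in> V \<Longrightarrow>
         distr (uniform_measure M {\<omega> \<in> space M. v0 \<omega> = v}) Q0 (y u t) =
           (if graph_dist E u v \<le> t then Q1 else Q0)"

(* Times range over enat, so that the library notion of stopping time applies to times that are
   only almost surely finite; the condition at time infinity is vacuous. *)
definition signal_filtration ::
  "'v set \<Rightarrow> 'w measure \<Rightarrow> 's measure \<Rightarrow> ('v \<Rightarrow> nat \<Rightarrow> 'w \<Rightarrow> 's) \<Rightarrow> enat \<Rightarrow> 'w measure" where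
  "signal_filtration V M S y t =
     sigma (space M) {y u s -` A \<inter> space M | u s A. u \<in> V \<and> enat s \<le> t \<and> A \<in> sets S}"

definition stop_times :: "'w measure \<Rightarrow> (enat \<Rightarrow> 'w measure) \<Rightarrow> nat \<Rightarrow> ('w \<Rightarrow> enat) set" where
  "stop_times M F s =
     {T. stopping_time F T \<and> (AE \<omega> in M. T \<omega> < \<infinity>) \<and> (AE \<omega> in M. enat s \<le> T \<omega>)}"

definition estimators :: "(enat \<Rightarrow> 'w measure) \<Rightarrow> (nat \<Rightarrow> 'w \<Rightarrow> real ^ 'k) set" where
  "estimators F = {w. \<forall>t. w t \<in> borel_measurable (F (enat t))}"

definition vec_cond_exp ::
  "'w measure \<Rightarrow> 'w measure \<Rightarrow> ('w \<Rightarrow> real ^ 'k) \<Rightarrow> 'w \<Rightarrow> real ^ 'k" where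
  "vec_cond_exp M G X \<omega> = (\<chi> i. real_cond_exp M G (\<lambda>\<omega>. X \<omega> $ i) \<omega>)"

(* Unlike real_cond_exp, this keeps the value -\<infinity> where only the negative part has infinite
   conditional expectation. *)
definition ereal_cond_exp :: "'w measure \<Rightarrow> 'w measure \<Rightarrow> ('w \<Rightarrow> real) \<Rightarrow> 'w \<Rightarrow> ereal" where
  "ereal_cond_exp M G f \<omega> =
     enn2ereal (nn_cond_exp M G (\<lambda>\<omega>. ennreal (f \<omega>)) \<omega>) -
     enn2ereal (nn_cond_exp M G (\<lambda>\<omega>. ennreal (- f \<omega>)) \<omega>)"

(* Y is a G-measurable version of the essential supremum of the family XX of random variables
   (to be distinguished from esssup, the essential supremum of a single function). *)
definition is_ess_sup ::
  "'w measure \<Rightarrow> 'w measure \<Rightarrow> ('w \<Rightarrow> ereal) set \<Rightarrow> ('w \<Rightarrow> ereal) \<Rightarrow> bool" where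
  "is_ess_sup M G XX Y \<longleftrightarrow>
     Y \<in> borel_measurable G \<and>
     (\<forall>X\<in>XX. AE \<omega> in M. X \<omega> \<le> Y \<omega>) \<and>
     (\<forall>Z\<in>borel_measurable M. (\<forall>X\<in>XX. AE \<omega> in M. X \<omega> \<le> Z \<omega>) \<longrightarrow> (AE \<omega> in M. Y \<omega> \<le> Z \<omega>))"

(* the_enat is unspecified at infinity; it is only used for almost surely finite times. *)
definition stopping_gain ::
  "'v set \<Rightarrow> ('v \<times> 'v) set \<Rightarrow> (nat \<Rightarrow> 'w \<Rightarrow> real ^ 'k) \<Rightarrow> nat \<Rightarrow> ('w \<Rightarrow> enat) \<Rightarrow> 'w \<Rightarrow> real" where
  "stopping_gain V E w s T \<omega> =
     (norm (w (the_enat (T \<omega>)) \<omega> - w s \<omega>))\<^sup>2 -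
     (real (nbhd_size V E (the_enat (T \<omega>))) - real (nbhd_size V E s))"

definition first_zero :: "(nat \<Rightarrow> 'w \<Rightarrow> ereal) \<Rightarrow> 'w \<Rightarrow> enat" where
  "first_zero Y \<omega> = Inf {enat s | s. Y s \<omega> = 0}"

definition cost ::
  "(real ^ 'k) set \<Rightarrow> ((real ^ 'k) \<times> (real ^ 'k)) set \<Rightarrow> 'w measure \<Rightarrow> ('w \<Rightarrow> real ^ 'k) \<Rightarrow>
   ('w \<Rightarrow> enat) \<Rightarrow> (nat \<Rightarrow> 'w \<Rightarrow> real ^ 'k) \<Rightarrow> ennreal" where
  "cost V E M v0 T w =
     (\<integral>\<^sup>+ \<omega>. ennreal ((norm (v0 \<omega> - w (the_enat (T \<omega>)) \<omega>))\<^sup>2 +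
                    real (card (nbhd V E (v0 \<omega>) (the_enat (T \<omega>))))) \<partial>M)"

definition optimal ::
  "(real ^ 'k) set \<Rightarrow> ((real ^ 'k) \<times> (real ^ 'k)) set \<Rightarrow> 'w measure \<Rightarrow> (enat \<Rightarrow> 'w measure) \<Rightarrow>
   ('w \<Rightarrow> real ^ 'k) \<Rightarrow> ('w \<Rightarrow> enat) \<Rightarrow> (nat \<Rightarrow> 'w \<Rightarrow> real ^ 'k) \<Rightarrow> bool" where
  "optimal V E M F v0 T w \<longleftrightarrow>
     T \<in> stop_times M F 0 \<and> w \<in> estimators F \<and>
     (\<forall>T'\<in>stop_times M F 0. \<forall>w'\<in>estimators F. cost V E M v0 T w \<le> cost V E M v0 T' w')"

end

theory Submission
  imports Defs
begin

text \<open>Write \<open>J(T)\<close> for the cost of stopping at \<open>T\<close> with the conditional mean. Pythagoras for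
  conditional means shows that no other estimator does better, and that for \<open>T \<ge> s\<close> the
  conditional gain \<open>E[f\<^sub>s(T) | F\<^sub>s]\<close> is the conditional decrease of the cost when \<open>s\<close> is
  replaced by \<open>T\<close>. Starting from any stopping time \<open>T\<close> of finite cost, the supremum \<open>S\<close> of an
  increasing sequence of nearly optimal continuations satisfies \<open>J(S) \<le> J(T)\<close> and cannot be improved
  by continuing further; it is almost surely finite because the ball sizes tend to infinity. On
  \<open>{S = s}\<close> all conditional gains are therefore nonpositive, so the essential supremum vanishes there
  and the first zero \<open>\<tau>\<close> is at most \<open>S\<close>. On \<open>{\<tau> = s}\<close> no continuation has positive conditional
  gain, whence \<open>J(\<tau>) \<le> J(S) \<le> J(T)\<close>.\<close>

section \<open>Balls in transitive graphs\<close>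

context transitive_graph
begin

text \<open>Connectedness provides a walk of some length, so the \<open>LEAST\<close> in
  \<open>graph_dist\<close> is attained.\<close>

lemma graph_dist_le_iff:
  assumes "u \<in> V" "v \<in> V"
  shows "graph_dist E u v \<le> t \<longleftrightarrow> (\<exists>n\<le>t. (u, v) \<in> E ^^ n)"
proof -
  obtain m where "(u, v) \<in> E ^^ m"
    using connected[OF assms] rtrancl_power by blast
  then have "(u, v) \<in> E ^^ graph_dist E u v"
    unfolding graph_dist_def by (rule LeastI)
  moreover have "graph_dist E u v \<le> n" if "(u, v) \<in> E ^^ n" for n
    unfolding graph_dist_def using that by (rule Least_le)
  ultimately show ?thesis
    using order_trans by blast
qed

text \<open>Induction on the length: by symmetry the last edge enters \<open>v\<close> from one of
  its finitely many neighbours. Outside \<open>V\<close> there are no edges at all.\<close>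

lemma finite_relpow_preimage: "finite {u. (u, v) \<in> E ^^ n}"
proof (induction n arbitrary: v)
  case 0
  then show ?case by simp
next
  case (Suc n)
  have "finite (E `` {v})"
  proof (cases "v \<in> V")
    case False
    then have "E `` {v} = {}"
      using edges by auto
    then show ?thesis by simp
  qed (rule locally_finite)
  then have "finite (\<Union>w\<in>E `` {v}. {u. (u, w) \<in> E ^^ n})"
    using Suc by blast
  moreover have "{u. (u, v) \<in> E ^^ Suc n} \<subseteq> (\<Union>w\<in>E `` {v}. {u. (u, w) \<in> E ^^ n})"
    using sym_edges by (auto dest: symD)
  ultimately show ?case
    by (rule rev_finite_subset)
qed

lemma finite_nbhd:
  assumes "v \<in> V"
  shows "finite (nbhd V E v t)"
proof (rule finite_subset)
  show "nbhd V E v t \<subseteq> (\<Union>n\<le>t. {u. (u, v) \<in> E ^^ n})"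
    using assms by (auto simp: nbhd_def graph_dist_le_iff)
qed (simp add: finite_relpow_preimage)

lemma relpow_automorphism:
  assumes "graph_automorphism V E \<phi>" "u \<in> V" "(u, v) \<in> E ^^ n"
  shows "(\<phi> u, \<phi> v) \<in> E ^^ n"
  using assms(3)
proof (induction n arbitrary: v)
  case (Suc n)
  then obtain w where "(u, w) \<in> E ^^ n" "(w, v) \<in> E"
    by auto
  moreover from this have "(\<phi> w, \<phi> v) \<in> E"
    using assms(1) edges unfolding graph_automorphism_def by blast
  ultimately show ?case
    using Suc.IH by auto
qed simp

text \<open>An automorphism carrying \<open>v\<close> to \<open>w\<close> preserves walks, hence
  embeds one ball into the other. Exchanging \<open>v\<close> and \<open>w\<close> yields
  equality.\<close>

lemma card_nbhd_le:
  assumes "v \<in> V" "w \<in> V"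
  shows "card (nbhd V E v t) \<le> card (nbhd V E w t)"
proof -
  obtain \<phi> where \<phi>: "graph_automorphism V E \<phi>" "\<phi> v = w"
    using vertex_transitive assms by blast
  then have bij: "bij_betw \<phi> V V"
    by (simp add: graph_automorphism_def)
  show ?thesis
  proof (rule card_inj_on_le)
    show "inj_on \<phi> (nbhd V E v t)"
      using bij by (auto simp: bij_betw_def nbhd_def intro: inj_on_subset)
    show "\<phi> ` nbhd V E v t \<subseteq> nbhd V E w t"
    proof
      fix z assume "z \<in> \<phi> ` nbhd V E v t"
      then obtain u where u: "z = \<phi> u" "u \<in> V" "graph_dist E u v \<le> t"
        by (auto simp: nbhd_def)
      moreover have "\<phi> u \<in> V"
        using bij u by (auto simp: bij_betw_def)
      ultimately show "z \<in> nbhd V E w t"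
        using assms \<phi> relpow_automorphism[OF \<phi>(1)] by (auto simp: nbhd_def graph_dist_le_iff)
    qed
  qed (use assms finite_nbhd in auto)
qed

text \<open>Justifies the definite description in \<open>nbhd_size\<close>.\<close>

lemma card_nbhd_eq_nbhd_size:
  assumes "v \<in> V"
  shows "card (nbhd V E v t) = nbhd_size V E t"
  unfolding nbhd_size_def
  by (rule the_equality[symmetric]) (use assms card_nbhd_le in \<open>auto intro!: antisym\<close>)

lemma mono_nbhd_size: "mono (nbhd_size V E)"
proof
  fix s t :: nat assume "s \<le> t"
  obtain v where v: "v \<in> V"
    using infinite_vertices by (metis finite.emptyI ex_in_conv)
  have "card (nbhd V E v s) \<le> card (nbhd V E v t)"
    using \<open>s \<le> t\<close> v by (intro card_mono finite_nbhd) (auto simp: nbhd_def)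
  then show "nbhd_size V E s \<le> nbhd_size V E t"
    by (simp add: card_nbhd_eq_nbhd_size v)
qed

lemma nbhd_size_unbounded: "\<exists>t. K \<le> nbhd_size V E t"
proof -
  obtain v where v: "v \<in> V"
    using infinite_vertices by (metis finite.emptyI ex_in_conv)
  obtain S where S: "S \<subseteq> V" "finite S" "card S = K"
    using infinite_arbitrarily_large[OF infinite_vertices] by blast
  \<comment> \<open>A crude radius: the sum of the distances dominates each of them, so the ball
    contains all of \<open>S\<close>.\<close>
  define t where "t = (\<Sum>u\<in>S. graph_dist E u v)"
  have "S \<subseteq> nbhd V E v t"
    using S by (auto simp: nbhd_def t_def intro: member_le_sum)
  then have "K \<le> card (nbhd V E v t)"
    using S v finite_nbhd card_mono by blast
  then show ?thesis
    using card_nbhd_eq_nbhd_size[OF v] by auto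
qed

end

section \<open>Integrals and conditional expectations\<close>

lemma nn_set_integral_le_space: "(\<integral>\<^sup>+\<omega>\<in>B. f \<omega> \<partial>M) \<le> (\<integral>\<^sup>+\<omega>. f \<omega> \<partial>M)"
  by (intro nn_integral_mono) (auto split: split_indicator)

lemma nn_integral_disjoint_family:
  fixes f :: "'a \<Rightarrow> ennreal" and D :: "nat \<Rightarrow> 'a set"
  assumes [measurable]: "f \<in> borel_measurable M" "\<And>n. D n \<in> sets M"
    and "disjoint_family D" "AE x in M. x \<in> (\<Union>n. D n)"
  shows "(\<integral>\<^sup>+x. f x \<partial>M) = (\<Sum>n. \<integral>\<^sup>+x\<in>D n. f x \<partial>M)"
proof -
  have "(\<integral>\<^sup>+x. f x \<partial>M) = (\<integral>\<^sup>+x. (\<Sum>n. f x * indicator (D n) x) \<partial>M)"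
    using assms(4)
  proof (intro nn_integral_cong_AE, eventually_elim)
    case (elim x)
    then show ?case
      by (auto simp: suminf_cmult_indicator[OF assms(3), of x _ "\<lambda>_. f x"] simp del: ennreal_suminf_cmult)
  qed
  also have "\<dots> = (\<Sum>n. \<integral>\<^sup>+x\<in>D n. f x \<partial>M)"
    by (intro nn_integral_suminf) simp
  finally show ?thesis .
qed

section \<open>Existence of essential suprema\<close>

text \<open>The family is compared with countably many of its members one rational level at a time: for
  each level \<open>q\<close>, a countable subfamily exhausts the measure of the sets \<open>{X > q}\<close>.\<close>

lemma is_ess_sup_exists:
  assumes "prob_space M" and G: "subalgebra M G"
    and XX: "\<And>X. X \<in> XX \<Longrightarrow> X \<in> borel_measurable G"
  shows "\<exists>Y. is_ess_sup M G XX Y"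
proof -
  interpret prob_space M by fact
  have XXM: "X \<in> borel_measurable M" if "X \<in> XX" for X
    using measurable_from_subalg[OF G XX[OF that]] .
  define U where "U q C = (\<Union>X\<in>C. {\<omega> \<in> space M. ereal (of_rat q) < X \<omega>})" for q C
  have U_sets: "U q C \<in> sets M" if "countable C" "C \<subseteq> XX" for q C
    unfolding U_def
  proof (rule sets.countable_UN''[OF that(1)])
    fix X assume "X \<in> C"
    then have [measurable]: "X \<in> borel_measurable M"
      using that XXM by blast
    show "{\<omega> \<in> space M. ereal (of_rat q) < X \<omega>} \<in> sets M"
      by measurable
  qed
  define CC where "CC = {C. countable C \<and> C \<subseteq> XX}"
  have "\<exists>C\<in>CC. \<forall>C'\<in>CC. prob (U q C') \<le> prob (U q C)" for q
  proof -
    define m where "m = (SUP C\<in>CC. prob (U q C))"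
    have bdd: "bdd_above ((\<lambda>C. prob (U q C)) ` CC)"
      by (auto intro!: bdd_aboveI[of _ 1])
    have ne: "CC \<noteq> {}"
      by (auto simp: CC_def)
    have "\<exists>C\<in>CC. m - 1 / real (Suc n) < prob (U q C)" for n
      using less_cSUP_iff[OF ne bdd, of "m - 1 / real (Suc n)"] by (simp add: m_def)
    then obtain C where C: "\<And>n. C n \<in> CC" "\<And>n. m - 1 / real (Suc n) < prob (U q (C n))"
      by metis
    \<comment> \<open>Merging the countably many near-maximizers stays countable and can only
      enlarge \<open>U q\<close>, so the supremum is attained.\<close>
    let ?C = "\<Union>n. C n"
    have mem: "?C \<in> CC"
      using C(1) by (auto simp: CC_def)
    have "m - 1 / real (Suc n) \<le> prob (U q ?C)" for n
    proof -
      have "prob (U q (C n)) \<le> prob (U q ?C)"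
        using mem by (intro finite_measure_mono U_sets) (auto simp: U_def CC_def)
      then show ?thesis
        using C(2)[of n] by linarith
    qed
    moreover have "(\<lambda>n. m - 1 / real (Suc n)) \<longlonglongrightarrow> m - 0"
      by (intro tendsto_diff tendsto_const LIMSEQ_Suc[OF lim_1_over_n])
    ultimately have "m \<le> prob (U q ?C)"
      by (intro LIMSEQ_le_const2[where x = m]) auto
    moreover have "prob (U q C') \<le> m" if "C' \<in> CC" for C'
      unfolding m_def using that bdd by (rule cSUP_upper)
    ultimately show ?thesis
      using mem by (meson order_trans)
  qed
  then obtain C where C: "\<And>q. C q \<in> CC" "\<And>q C'. C' \<in> CC \<Longrightarrow> prob (U q C') \<le> prob (U q (C q))"
    by metis
  define D where "D = (\<Union>q. C q)"
  have D: "countable D" "D \<subseteq> XX" "D \<in> CC"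
    using C(1) by (auto simp: D_def CC_def)
  define Y where "Y \<omega> = (SUP X\<in>D. X \<omega>)" for \<omega>
  have "Y \<in> borel_measurable G"
    unfolding Y_def using D XX by (intro borel_measurable_SUP) auto
  moreover have "AE \<omega> in M. X \<omega> \<le> Y \<omega>" if "X \<in> XX" for X
  proof -
    have X [measurable]: "X \<in> borel_measurable M"
      using XXM that .
    have "AE \<omega> in M. ereal (of_rat q) < X \<omega> \<longrightarrow> ereal (of_rat q) < Y \<omega>" for q
    proof -
      \<comment> \<open>\<open>D\<close> attains the maximal measure at level \<open>q\<close>, so
        adjoining \<open>X\<close> enlarges \<open>U q D\<close> by a null set only.\<close>
      have insCC: "insert X D \<in> CC"
        using D that by (auto simp: CC_def)
      have "prob (U q (insert X D)) \<le> prob (U q (C q))"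
        using C(2) insCC .
      also have "\<dots> \<le> prob (U q D)"
        by (intro finite_measure_mono U_sets D) (auto simp: U_def D_def)
      finally have "prob (U q (insert X D)) \<le> prob (U q D)" .
      moreover have "prob (U q (insert X D) - U q D) = prob (U q (insert X D)) - prob (U q D)"
        using insCC D by (intro finite_measure_Diff U_sets) (auto simp: U_def CC_def)
      ultimately have "prob (U q (insert X D) - U q D) = 0"
        using measure_nonneg[of M "U q (insert X D) - U q D"] by linarith
      then have "AE \<omega> in M. \<omega> \<notin> U q (insert X D) - U q D"
        using insCC by (intro AE_not_in) (auto simp: null_sets_def emeasure_eq_measure CC_def U_sets D)
      then show ?thesis
      proof (rule AE_mp, intro AE_I2 impI)
        fix \<omega> assume "\<omega> \<in> space M" "\<omega> \<notin> U q (insert X D) - U q D" "ereal (of_rat q) < X \<omega>"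
        then obtain X' where "X' \<in> D" "ereal (of_rat q) < X' \<omega>"
          by (auto simp: U_def)
        then show "ereal (of_rat q) < Y \<omega>"
          unfolding Y_def by (auto simp: less_SUP_iff)
      qed
    qed
    then have "AE \<omega> in M. \<forall>q. ereal (of_rat q) < X \<omega> \<longrightarrow> ereal (of_rat q) < Y \<omega>"
      by (simp add: AE_all_countable)
    then show ?thesis
    proof (rule AE_mp, intro AE_I2 impI)
      fix \<omega> assume q: "\<forall>q. ereal (of_rat q) < X \<omega> \<longrightarrow> ereal (of_rat q) < Y \<omega>"
      show "X \<omega> \<le> Y \<omega>"
      proof (rule ccontr)
        assume "\<not> X \<omega> \<le> Y \<omega>"
        then obtain a b where ab: "Y \<omega> < ereal a" "ereal a < ereal b" "ereal b < X \<omega>"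
          using ereal_dense2 by (metis not_le)
        then obtain q where "a < of_rat q" "of_rat q < b"
          using of_rat_dense by auto
        then have "ereal (of_rat q) < X \<omega>" "\<not> ereal (of_rat q) < Y \<omega>"
          using ab by (auto simp: not_less) (meson ereal_less_eq(3) less_imp_le less_le_trans less_ereal.simps(1) less_trans order_trans)+
        with q show False
          by blast
      qed
    qed
  qed
  moreover have "AE \<omega> in M. Y \<omega> \<le> Z \<omega>" if "\<forall>X\<in>XX. AE \<omega> in M. X \<omega> \<le> Z \<omega>" for Z
  proof -
    have "AE \<omega> in M. \<forall>X\<in>D. X \<omega> \<le> Z \<omega>"
      using that D by (subst AE_ball_countable) auto
    then show ?thesis
      by eventually_elim (auto simp: Y_def intro: SUP_least)
  qed
  ultimately show ?thesis
    by (auto simp: is_ess_sup_def)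
qed

section \<open>Pythagoras for conditional means\<close>

text \<open>Orthogonality of \<open>X - m\<close> to \<open>F\<close>-measurable functions kills the
  cross term. As \<open>Z\<close> is merely measurable, the identity is proved on pieces where
  \<open>m\<close> and \<open>Z\<close> are bounded and then summed; both sides may be
  infinite.\<close>

lemma (in sigma_finite_subalgebra) real_cond_exp_pythagoras:
  fixes X Z :: "'a \<Rightarrow> real"
  assumes X [measurable]: "X \<in> borel_measurable M" and X2: "integrable M (\<lambda>x. (X x)\<^sup>2)"
    and X1: "integrable M X" and fin: "finite_measure M"
    and Z [measurable]: "Z \<in> borel_measurable F" and A [measurable]: "A \<in> sets F"
  defines "m \<equiv> real_cond_exp M F X"
  shows "(\<integral>\<^sup>+x\<in>A. ennreal ((X x - Z x)\<^sup>2) \<partial>M) =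
    (\<integral>\<^sup>+x\<in>A. ennreal ((X x - m x)\<^sup>2) \<partial>M) + (\<integral>\<^sup>+x\<in>A. ennreal ((m x - Z x)\<^sup>2) \<partial>M)"
proof -
  interpret finite_measure M by fact
  have mF [measurable]: "m \<in> borel_measurable F"
    by (simp add: m_def)
  have M [measurable]: "m \<in> borel_measurable M" "Z \<in> borel_measurable M" "A \<in> sets M"
    using measurable_from_subalg[OF subalg mF] measurable_from_subalg[OF subalg Z] A subalg
    by (auto simp: subalgebra_def)
  \<comment> \<open>The \<open>D n\<close> partition the space into sets of \<open>F\<close> on
    which \<open>m\<close> and \<open>Z\<close> are bounded by \<open>n + 1\<close>.\<close>
  define D where "D n = {x \<in> space M. nat \<lfloor>\<bar>m x\<bar> + \<bar>Z x\<bar>\<rfloor> = n}" for n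
  have spF: "space F = space M"
    using subalg by (simp add: subalgebra_def)
  have DF [measurable]: "D n \<in> sets F" for n
    unfolding D_def spF[symmetric] by measurable
  have DM [measurable]: "D n \<in> sets M" for n
    using DF subalg by (auto simp: subalgebra_def)
  have split: "(\<integral>\<^sup>+x\<in>A. f x \<partial>M) = (\<Sum>n. \<integral>\<^sup>+x\<in>A \<inter> D n. f x \<partial>M)"
    if [measurable]: "f \<in> borel_measurable M" for f :: "'a \<Rightarrow> ennreal"
  proof -
    have "(\<integral>\<^sup>+x\<in>A. f x \<partial>M) = (\<Sum>n. \<integral>\<^sup>+x\<in>D n. (f x * indicator A x) \<partial>M)"
      by (intro nn_integral_disjoint_family) (auto simp: D_def disjoint_family_on_def)
    then show ?thesis
      by (simp add: indicator_inter_arith mult.assoc)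
  qed
  have piece: "(\<integral>\<^sup>+x\<in>A \<inter> D n. ennreal ((X x - Z x)\<^sup>2) \<partial>M) =
    (\<integral>\<^sup>+x\<in>A \<inter> D n. ennreal ((X x - m x)\<^sup>2) \<partial>M) + (\<integral>\<^sup>+x\<in>A \<inter> D n. ennreal ((m x - Z x)\<^sup>2) \<partial>M)" for n
  proof -
    define i where "i x = (indicator (A \<inter> D n) x :: real)" for x
    have iF [measurable]: "i \<in> borel_measurable F" and iM [measurable]: "i \<in> borel_measurable M"
      unfolding i_def by measurable
    have i2: "i x * i x = i x" "0 \<le> i x" for x
      by (auto simp: i_def split: split_indicator)
    have bnd: "\<bar>i x * m x\<bar> \<le> real n + 1" "\<bar>i x * Z x\<bar> \<le> real n + 1" for x
    proof -
      have "\<bar>m x\<bar> + \<bar>Z x\<bar> \<le> real n + 1" if "x \<in> D n"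
        using that by (simp add: D_def) linarith
      then show "\<bar>i x * m x\<bar> \<le> real n + 1" "\<bar>i x * Z x\<bar> \<le> real n + 1"
        by (auto simp: i_def split: split_indicator)
    qed
    have bounded_int: "integrable M f" if "f \<in> borel_measurable M" "\<And>x. \<bar>f x\<bar> \<le> B"
      for f :: "'a \<Rightarrow> real" and B
      using that by (intro integrable_const_bound[of _ B]) auto
    have intX: "integrable M (\<lambda>x. f x * X x)"
      if [measurable]: "f \<in> borel_measurable M" and "\<And>x. \<bar>f x\<bar> \<le> B" for f :: "'a \<Rightarrow> real" and B
    proof (rule Bochner_Integration.integrable_bound)
      show "integrable M (\<lambda>x. B * X x)"
        using X1 by simp
      show "AE x in M. norm (f x * X x) \<le> norm (B * X x)"
        using that(2) by (auto simp: abs_mult intro!: mult_right_mono order_trans[OF that(2)])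
    qed simp
    \<comment> \<open>The cross term is twice \<open>h * (X - m)\<close> with \<open>h\<close>
      bounded and \<open>F\<close>-measurable, so its integral vanishes by the defining property of
      \<open>m\<close>.\<close>
    define h where "h x = i x * (m x - Z x)" for x
    have hF [measurable]: "h \<in> borel_measurable F" and hM [measurable]: "h \<in> borel_measurable M"
      unfolding h_def by measurable
    have hb: "\<bar>h x\<bar> \<le> 2 * (real n + 1)" for x
      using bnd[of x] abs_triangle_ineq4[of "i x * m x" "i x * Z x"]
      unfolding h_def right_diff_distrib by simp
    have ihX: "integrable M (\<lambda>x. h x * X x)"
      using intX[OF hM hb] .
    note ihm = real_cond_exp_intg[OF ihX hF X, folded m_def]
    have i_sq: "integrable M (\<lambda>x. i x * (X x)\<^sup>2)"
      using X2 by (rule Bochner_Integration.integrable_bound)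
        (auto simp: i_def split: split_indicator)
    have imX: "integrable M (\<lambda>x. (i x * m x) * X x)"
      by (rule intX[OF _ bnd(1)]) simp
    have imm: "integrable M (\<lambda>x. (i x * m x) * (i x * m x))"
      by (rule bounded_int[where B = "(real n + 1) * (real n + 1)"])
         (use bnd in \<open>auto simp: abs_mult intro!: mult_mono\<close>)
    have ihh: "integrable M (\<lambda>x. h x * h x)"
      by (rule bounded_int[where B = "(2 * (real n + 1)) * (2 * (real n + 1))"])
         (use hb in \<open>auto simp only: abs_mult hM borel_measurable_times intro!: mult_mono\<close>, auto)
    have e1: "i x * (X x - m x)\<^sup>2 = i x * (X x)\<^sup>2 - 2 * ((i x * m x) * X x) + (i x * m x) * (i x * m x)" for x
      by (auto simp: i_def power2_eq_square algebra_simps split: split_indicator)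
    have I1: "integrable M (\<lambda>x. i x * (X x - m x)\<^sup>2)"
      unfolding e1 using i_sq imX imm by (intro Bochner_Integration.integrable_add Bochner_Integration.integrable_diff integrable_mult_right) auto
    have e2: "i x * (m x - Z x)\<^sup>2 = h x * h x" for x
      by (auto simp: i_def h_def power2_eq_square split: split_indicator)
    have I2: "integrable M (\<lambda>x. i x * (m x - Z x)\<^sup>2)"
      unfolding e2 by (rule ihh)
    have e3: "i x * (X x - Z x)\<^sup>2 =
      i x * (X x - m x)\<^sup>2 + i x * (m x - Z x)\<^sup>2 + 2 * (h x * X x - h x * m x)" for x
      by (auto simp: i_def h_def power2_eq_square algebra_simps split: split_indicator)
    have I3: "integrable M (\<lambda>x. i x * (X x - Z x)\<^sup>2)"
      unfolding e3 using I1 I2 ihX ihm by (intro Bochner_Integration.integrable_add Bochner_Integration.integrable_diff integrable_mult_right) auto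
    have "(\<integral>x. i x * (X x - Z x)\<^sup>2 \<partial>M) = (\<integral>x. i x * (X x - m x)\<^sup>2 \<partial>M) + (\<integral>x. i x * (m x - Z x)\<^sup>2 \<partial>M)"
      unfolding e3 using I1 I2 ihX ihm by simp
    moreover have "(\<integral>\<^sup>+x\<in>A \<inter> D n. ennreal (g x) \<partial>M) = ennreal (\<integral>x. i x * g x \<partial>M)"
      if "integrable M (\<lambda>x. i x * g x)" "\<And>x. 0 \<le> g x" for g
    proof -
      have "(\<integral>\<^sup>+x\<in>A \<inter> D n. ennreal (g x) \<partial>M) = (\<integral>\<^sup>+x. ennreal (i x * g x) \<partial>M)"
        by (intro nn_integral_cong) (auto simp: i_def split: split_indicator)
      also have "\<dots> = ennreal (\<integral>x. i x * g x \<partial>M)"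
        using that i2 by (intro nn_integral_eq_integral) auto
      finally show ?thesis .
    qed
    ultimately show ?thesis
      using I1 I2 I3 i2 by (simp add: ennreal_plus)
  qed
  show ?thesis
    by (simp add: split piece suminf_add)
qed

lemma power2_norm_vec: "(norm x)\<^sup>2 = (\<Sum>i\<in>UNIV. (x $ i)\<^sup>2)" for x :: "real ^ 'k"
  unfolding power2_norm_eq_inner by (simp add: inner_vec_def power2_eq_square)

lemma borel_measurable_vec_nth [measurable (raw)]:
  fixes f :: "'a \<Rightarrow> real ^ 'k"
  assumes "f \<in> borel_measurable M"
  shows "(\<lambda>\<omega>. f \<omega> $ i) \<in> borel_measurable M"
  using assms by (rule measurable_compose)
    (intro borel_measurable_continuous_onI linear_continuous_on bounded_linear_vec_nth)

lemma borel_measurable_vec_cond_exp: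
  fixes X :: "'a \<Rightarrow> real ^ 'k"
  shows "vec_cond_exp M G X \<in> borel_measurable G"
proof (subst borel_measurable_euclidean_space, intro ballI)
  fix b :: "real ^ 'k" assume "b \<in> Basis"
  then obtain i where b: "b = axis i 1"
    by (auto simp: Basis_vec_def)
  show "(\<lambda>\<omega>. vec_cond_exp M G X \<omega> \<bullet> b) \<in> borel_measurable G"
    by (simp add: b inner_axis vec_cond_exp_def)
qed

text \<open>Squared norms and \<open>vec_cond_exp\<close> both split into coordinates, and each
  coordinate of \<open>X\<close> is square integrable, hence integrable on a probability
  space.\<close>

lemma vec_cond_exp_pythagoras:
  fixes X Z :: "'a \<Rightarrow> real ^ 'k"
  assumes "prob_space M" and G: "subalgebra M G"
    and X [measurable]: "X \<in> borel_measurable M" and X2: "integrable M (\<lambda>\<omega>. (norm (X \<omega>))\<^sup>2)"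
    and Z [measurable]: "Z \<in> borel_measurable G" and A: "A \<in> sets G"
  defines "m \<equiv> vec_cond_exp M G X"
  shows "(\<integral>\<^sup>+\<omega>\<in>A. ennreal ((norm (X \<omega> - Z \<omega>))\<^sup>2) \<partial>M) =
    (\<integral>\<^sup>+\<omega>\<in>A. ennreal ((norm (X \<omega> - m \<omega>))\<^sup>2) \<partial>M) + (\<integral>\<^sup>+\<omega>\<in>A. ennreal ((norm (m \<omega> - Z \<omega>))\<^sup>2) \<partial>M)"
proof -
  interpret prob_space M by fact
  interpret sigma_finite_subalgebra M G
    using G by (intro finite_measure_subalgebra_is_sigma_finite)
      (simp add: finite_measure_subalgebra_def finite_measure_subalgebra_axioms_def finite_measure_axioms)
  have m [measurable]: "m \<in> borel_measurable M"
    unfolding m_def by (rule measurable_from_subalg[OF G borel_measurable_vec_cond_exp])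
  have ZM [measurable]: "Z \<in> borel_measurable M"
    using measurable_from_subalg[OF G Z] .
  have AM [measurable]: "A \<in> sets M"
    using A G by (auto simp: subalgebra_def)
  have split: "(\<integral>\<^sup>+\<omega>\<in>A. ennreal ((norm (f \<omega>))\<^sup>2) \<partial>M) = (\<Sum>i\<in>UNIV. \<integral>\<^sup>+\<omega>\<in>A. ennreal ((f \<omega> $ i)\<^sup>2) \<partial>M)"
    if [measurable]: "f \<in> borel_measurable M" for f :: "'a \<Rightarrow> real ^ 'k"
  proof -
    have eq: "ennreal ((norm (f \<omega>))\<^sup>2) * indicator A \<omega> = (\<Sum>i\<in>UNIV. ennreal ((f \<omega> $ i)\<^sup>2) * indicator A \<omega>)" for \<omega>
      by (simp add: power2_norm_vec flip: sum_distrib_right)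
    have "(\<lambda>\<omega>. ennreal ((f \<omega> $ i)\<^sup>2) * indicator A \<omega>) \<in> borel_measurable M" for i
      by measurable
    then show ?thesis
      unfolding eq by (intro nn_integral_sum)
  qed
  have comp: "(\<integral>\<^sup>+\<omega>\<in>A. ennreal ((X \<omega> $ i - Z \<omega> $ i)\<^sup>2) \<partial>M) =
    (\<integral>\<^sup>+\<omega>\<in>A. ennreal ((X \<omega> $ i - m \<omega> $ i)\<^sup>2) \<partial>M) + (\<integral>\<^sup>+\<omega>\<in>A. ennreal ((m \<omega> $ i - Z \<omega> $ i)\<^sup>2) \<partial>M)" for i
  proof -
    have Xi [measurable]: "(\<lambda>\<omega>. X \<omega> $ i) \<in> borel_measurable M"
      by measurable
    have "(X \<omega> $ i)\<^sup>2 \<le> (norm (X \<omega>))\<^sup>2" for \<omega>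
      using component_le_norm_cart[of "X \<omega>" i] by (simp add: abs_le_square_iff[symmetric])
    then have sq: "integrable M (\<lambda>\<omega>. (X \<omega> $ i)\<^sup>2)"
      by (intro Bochner_Integration.integrable_bound[OF X2]) auto
    then have "integrable M (\<lambda>\<omega>. X \<omega> $ i)"
      by (rule square_integrable_imp_integrable[rotated]) simp
    then show ?thesis
      unfolding m_def vec_cond_exp_def vec_lambda_beta
      by (intro real_cond_exp_pythagoras[OF Xi sq] finite_measure_axioms borel_measurable_vec_nth[OF Z] A)
  qed
  show ?thesis
    by (simp add: split comp sum.distrib)
qed

section \<open>Signs of conditional gains\<close>

text \<open>In \<open>ereal\<close> the difference \<open>\<infinity> - \<infinity>\<close> is
  \<open>\<infinity>\<close>, so the equivalence would fail at
  \<open>a = b = \<infinity>\<close>.\<close>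

lemma ereal_diff_pos_iff:
  assumes "a \<noteq> \<infinity>"
  shows "0 < enn2ereal a - enn2ereal b \<longleftrightarrow> b < a"
  using assms by (cases a; cases b) (auto simp: ennreal_less_iff enn2ereal_ennreal)

lemma ereal_diff_nonpos_imp_le: "enn2ereal a - enn2ereal b \<le> 0 \<Longrightarrow> a \<le> b"
  by (cases a; cases b) (auto simp: enn2ereal_ennreal)

lemma borel_measurable_ereal_cond_exp: "ereal_cond_exp M G f \<in> borel_measurable G"
  unfolding ereal_cond_exp_def[abs_def] by measurable

section \<open>Optimal stopping of an estimation problem\<close>

text \<open>An infinite supremum may not be attained, but every finite level is reached: for
  \<open>n = Suc k\<close> the supremum exceeds \<open>k\<close> strictly, hence so does some
  \<open>T i\<close>.\<close>

lemma ex_le_SUP_enat: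
  fixes T :: "nat \<Rightarrow> enat"
  assumes "enat n \<le> (SUP i. T i)"
  shows "\<exists>i. enat n \<le> T i"
proof (cases n)
  case 0
  then show ?thesis by (simp add: zero_enat_def[symmetric])
next
  case (Suc k)
  then have "enat k < (SUP i. T i)"
    using assms by (meson enat_ord_simps(2) lessI less_le_trans)
  then obtain i where "enat k < T i"
    by (auto simp: less_SUP_iff)
  then show ?thesis
    unfolding Suc by (auto simp: Suc_ile_eq)
qed

section \<open>Stopping times and their levels\<close>

text \<open>The stopping problem without its graph: \<open>X\<close> stands for the source and
  \<open>N\<close> for the ball size. Unboundedness of \<open>N\<close> is what rules out never
  stopping.\<close>

locale stopped_estimation = prob_space M for M :: "'w measure" +
  fixes F :: "enat \<Rightarrow> 'w measure" and X :: "'w \<Rightarrow> real ^ 'k" and N :: "nat \<Rightarrow> nat"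
  assumes subalgebra_F: "subalgebra M (F t)"
    and F_mono: "s \<le> t \<Longrightarrow> sets (F s) \<subseteq> sets (F t)"
    and X_measurable [measurable]: "X \<in> borel_measurable M"
    and X_square_integrable: "integrable M (\<lambda>\<omega>. (norm (X \<omega>))\<^sup>2)"
    and N_mono: "mono N"
    and N_unbounded: "\<exists>t. K \<le> N t"
begin

abbreviation stops :: "nat \<Rightarrow> ('w \<Rightarrow> enat) set" where
  "stops \<equiv> stop_times M F"

definition vhat :: "nat \<Rightarrow> 'w \<Rightarrow> real ^ 'k" where
  "vhat t = vec_cond_exp M (F (enat t)) X"

text \<open>Where \<open>T\<close> is infinite the index is unspecified; for members of
  \<open>stops\<close> this concerns a null set only.\<close>

definition stopped :: "(nat \<Rightarrow> 'w \<Rightarrow> 'b) \<Rightarrow> ('w \<Rightarrow> enat) \<Rightarrow> 'w \<Rightarrow> 'b" where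
  "stopped w T \<omega> = w (the_enat (T \<omega>)) \<omega>"

definition level :: "('w \<Rightarrow> enat) \<Rightarrow> nat \<Rightarrow> 'w set" where
  "level T n = {\<omega> \<in> space M. T \<omega> = enat n}"

definition sq_error :: "nat \<Rightarrow> 'w \<Rightarrow> ennreal" where
  "sq_error n \<omega> = ennreal ((norm (X \<omega> - vhat n \<omega>))\<^sup>2)"

definition loss :: "nat \<Rightarrow> 'w \<Rightarrow> ennreal" where
  "loss n \<omega> = sq_error n \<omega> + of_nat (N n)"

definition gain :: "nat \<Rightarrow> ('w \<Rightarrow> enat) \<Rightarrow> 'w \<Rightarrow> real" where
  "gain s T \<omega> = (norm (stopped vhat T \<omega> - vhat s \<omega>))\<^sup>2 -
    (real (N (the_enat (T \<omega>))) - real (N s))"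

lemma space_F: "space (F t) = space M"
  using subalgebra_F by (simp add: subalgebra_def)

lemma sets_F_subset: "A \<in> sets (F t) \<Longrightarrow> A \<in> sets M"
  using subalgebra_F by (auto simp: subalgebra_def)

lemma measurable_F_mono: "f \<in> borel_measurable (F s) \<Longrightarrow> s \<le> t \<Longrightarrow> f \<in> borel_measurable (F t)"
  using F_mono[of s t] space_F unfolding measurable_def by auto

lemma sigma_finite_subalgebra_F: "sigma_finite_subalgebra M (F t)"
  by (intro finite_measure_subalgebra_is_sigma_finite)
    (simp add: finite_measure_subalgebra_def finite_measure_subalgebra_axioms_def
      finite_measure_axioms subalgebra_F)

lemma vhat_measurable_F: "vhat t \<in> borel_measurable (F (enat t))"
  unfolding vhat_def by (rule borel_measurable_vec_cond_exp)

lemma vhat_measurable [measurable]: "vhat t \<in> borel_measurable M"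
  using measurable_from_subalg[OF subalgebra_F vhat_measurable_F] .

lemma sq_error_measurable [measurable]: "sq_error n \<in> borel_measurable M"
  unfolding sq_error_def[abs_def] by measurable

lemma loss_measurable [measurable]: "loss n \<in> borel_measurable M"
  unfolding loss_def[abs_def] by measurable

lemma stopsD:
  assumes "T \<in> stops s"
  shows "stopping_time F T" "AE \<omega> in M. T \<omega> < \<infinity>" "AE \<omega> in M. enat s \<le> T \<omega>"
  using assms by (auto simp: stop_times_def)

lemma stops_0: "T \<in> stops s \<Longrightarrow> T \<in> stops 0"
  by (auto simp: stop_times_def zero_enat_def[symmetric])

lemma const_stops: "(\<lambda>_. enat s) \<in> stops s"
  by (simp add: stop_times_def stopping_time_const)

lemma max_stops:
  assumes "T \<in> stops 0"
  shows "(\<lambda>\<omega>. max (T \<omega>) (enat s)) \<in> stops s"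
  using stopsD[OF assms] by (auto simp: stop_times_def intro: stopping_time_max stopping_time_const)

lemma stopping_time_le_sets:
  assumes "stopping_time F T" "s \<le> t"
  shows "{\<omega> \<in> space M. T \<omega> \<le> s} \<in> sets (F t)"
  using stopping_timeD[OF assms(1), of s] F_mono[OF assms(2)] space_F
  by (auto simp: Measurable.pred_def)

lemma level_F:
  assumes "stopping_time F T"
  shows "level T n \<in> sets (F (enat n))"
proof (cases n)
  case 0
  then have "level T n = {\<omega> \<in> space M. T \<omega> \<le> enat n}"
    by (auto simp: level_def zero_enat_def[symmetric])
  then show ?thesis
    using stopping_time_le_sets[OF assms] by simp
next
  case (Suc k)
  then have "level T n = {\<omega> \<in> space M. T \<omega> \<le> enat n} - {\<omega> \<in> space M. T \<omega> \<le> enat k}"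
    by (auto simp: level_def not_le Suc_ile_eq[symmetric])
  moreover have "{\<omega> \<in> space M. T \<omega> \<le> enat k} \<in> sets (F (enat n))"
    using Suc by (intro stopping_time_le_sets[OF assms]) simp
  ultimately show ?thesis
    using stopping_time_le_sets[OF assms, of "enat n" "enat n"] by simp
qed

lemma level_sets [measurable (raw)]: "stopping_time F T \<Longrightarrow> level T n \<in> sets M"
  using level_F sets_F_subset by blast

text \<open>As \<open>enat\<close> is countable, single values suffice, and
  \<open>T = \<infinity>\<close> is the complement of all levels.\<close>

lemma stopping_time_measurable:
  assumes "stopping_time F T"
  shows "T \<in> measurable M (count_space UNIV)"
proof (subst measurable_count_space_eq_countable, simp, intro conjI ballI)
  fix a
  show "T -` {a} \<inter> space M \<in> sets M"
  proof (cases a)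
    case (enat n)
    then have "T -` {a} \<inter> space M = level T n"
      by (auto simp: level_def)
    then show ?thesis
      using level_sets[OF assms] by simp
  next
    case infinity
    then have "T -` {a} \<inter> space M = space M - (\<Union>n. level T n)"
      by (auto simp: level_def)
    then show ?thesis
      using level_sets[OF assms] by auto
  qed
qed simp

lemma stopped_measurable:
  assumes "stopping_time F T" "\<And>n. w n \<in> borel_measurable M"
  shows "stopped w T \<in> borel_measurable M"
  unfolding stopped_def[abs_def]
  by (rule measurable_compose_countable[where f = w, OF assms(2)])
    (rule measurable_compose[OF stopping_time_measurable[OF assms(1)]], simp)

lemma stopped_level: "\<omega> \<in> level T n \<Longrightarrow> stopped w T \<omega> = w n \<omega>"
  by (simp add: stopped_def level_def)

lemma nn_integral_levels:
  assumes "T \<in> stops 0" and [measurable]: "f \<in> borel_measurable M"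
  shows "(\<integral>\<^sup>+\<omega>. f \<omega> \<partial>M) = (\<Sum>n. \<integral>\<^sup>+\<omega>\<in>level T n. f \<omega> \<partial>M)"
proof (rule nn_integral_disjoint_family)
  show "AE \<omega> in M. \<omega> \<in> (\<Union>n. level T n)"
    using stopsD(2)[OF assms(1)] by (auto simp: level_def)
  show "disjoint_family (level T)"
    by (auto simp: disjoint_family_on_def level_def)
qed (use stopsD(1)[OF assms(1)] level_sets in auto)

section \<open>Estimation error at stopping times\<close>

text \<open>On \<open>level T n\<close> the time is the constant \<open>n\<close>, where Pythagoras
  for a fixed \<sigma>-algebra applies. Assumption \<open>AF\<close> says that \<open>A\<close>
  belongs to the past of \<open>T\<close>.\<close>

lemma stopped_pythagoras:
  assumes T: "T \<in> stops 0" and A [measurable]: "A \<in> sets M"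
    and AF: "\<And>n. A \<inter> level T n \<in> sets (F (enat n))"
    and w: "\<And>n. w n \<in> borel_measurable (F (enat n))"
  shows "(\<integral>\<^sup>+\<omega>\<in>A. ennreal ((norm (X \<omega> - stopped w T \<omega>))\<^sup>2) \<partial>M) =
    (\<integral>\<^sup>+\<omega>\<in>A. stopped sq_error T \<omega> \<partial>M) +
    (\<integral>\<^sup>+\<omega>\<in>A. ennreal ((norm (stopped vhat T \<omega> - stopped w T \<omega>))\<^sup>2) \<partial>M)"
proof -
  note st = stopsD(1)[OF T]
  have wM: "w n \<in> borel_measurable M" for n
    using measurable_from_subalg[OF subalgebra_F w] .
  have [measurable]: "stopped w T \<in> borel_measurable M" "stopped vhat T \<in> borel_measurable M"
    "stopped sq_error T \<in> borel_measurable M"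
    by (intro stopped_measurable[OF st] wM vhat_measurable sq_error_measurable)+
  have split: "(\<integral>\<^sup>+\<omega>\<in>A. f \<omega> \<partial>M) = (\<Sum>n. \<integral>\<^sup>+\<omega>\<in>A \<inter> level T n. f \<omega> \<partial>M)"
    if [measurable]: "f \<in> borel_measurable M" for f
  proof -
    have "(\<integral>\<^sup>+\<omega>\<in>A. f \<omega> \<partial>M) = (\<Sum>n. \<integral>\<^sup>+\<omega>\<in>level T n. (f \<omega> * indicator A \<omega>) \<partial>M)"
      using T by (intro nn_integral_levels) auto
    then show ?thesis
      by (simp add: indicator_inter_arith mult.assoc)
  qed
  have cong: "(\<integral>\<^sup>+\<omega>\<in>A \<inter> level T n. f \<omega> \<partial>M) = (\<integral>\<^sup>+\<omega>\<in>A \<inter> level T n. g \<omega> \<partial>M)"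
    if "\<And>\<omega>. \<omega> \<in> level T n \<Longrightarrow> f \<omega> = g \<omega>" for f g n
    using that by (intro nn_integral_cong) (auto split: split_indicator)
  have "(\<integral>\<^sup>+\<omega>\<in>A \<inter> level T n. ennreal ((norm (X \<omega> - stopped w T \<omega>))\<^sup>2) \<partial>M) =
    (\<integral>\<^sup>+\<omega>\<in>A \<inter> level T n. stopped sq_error T \<omega> \<partial>M) +
    (\<integral>\<^sup>+\<omega>\<in>A \<inter> level T n. ennreal ((norm (stopped vhat T \<omega> - stopped w T \<omega>))\<^sup>2) \<partial>M)" for n
  proof -
    have "(\<integral>\<^sup>+\<omega>\<in>A \<inter> level T n. ennreal ((norm (X \<omega> - stopped w T \<omega>))\<^sup>2) \<partial>M) =
      (\<integral>\<^sup>+\<omega>\<in>A \<inter> level T n. ennreal ((norm (X \<omega> - w n \<omega>))\<^sup>2) \<partial>M)"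
      by (rule cong) (simp add: stopped_level)
    also have "\<dots> = (\<integral>\<^sup>+\<omega>\<in>A \<inter> level T n. sq_error n \<omega> \<partial>M) +
        (\<integral>\<^sup>+\<omega>\<in>A \<inter> level T n. ennreal ((norm (vhat n \<omega> - w n \<omega>))\<^sup>2) \<partial>M)"
      unfolding sq_error_def vhat_def
      by (rule vec_cond_exp_pythagoras[OF prob_space_axioms subalgebra_F X_measurable
            X_square_integrable w AF])
    also have "(\<integral>\<^sup>+\<omega>\<in>A \<inter> level T n. sq_error n \<omega> \<partial>M) =
        (\<integral>\<^sup>+\<omega>\<in>A \<inter> level T n. stopped sq_error T \<omega> \<partial>M)"
      by (rule cong) (simp add: stopped_level)
    also have "(\<integral>\<^sup>+\<omega>\<in>A \<inter> level T n. ennreal ((norm (vhat n \<omega> - w n \<omega>))\<^sup>2) \<partial>M) =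
        (\<integral>\<^sup>+\<omega>\<in>A \<inter> level T n. ennreal ((norm (stopped vhat T \<omega> - stopped w T \<omega>))\<^sup>2) \<partial>M)"
      by (rule cong) (simp add: stopped_level)
    finally show ?thesis .
  qed
  then show ?thesis
    by (simp add: split suminf_add)
qed

text \<open>Stopped Pythagoras for the estimator that keeps the value \<open>vhat s\<close> from
  time \<open>s\<close> on.\<close>

lemma sq_error_increment:
  assumes T: "T \<in> stops s" and B: "B \<in> sets (F (enat s))"
  shows "(\<integral>\<^sup>+\<omega>\<in>B. sq_error s \<omega> \<partial>M) =
    (\<integral>\<^sup>+\<omega>\<in>B. stopped sq_error T \<omega> \<partial>M) +
    (\<integral>\<^sup>+\<omega>\<in>B. ennreal ((norm (stopped vhat T \<omega> - vhat s \<omega>))\<^sup>2) \<partial>M)"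
proof -
  note st = stopsD(1)[OF T]
  \<comment> \<open>This changes \<open>B\<close> by a null set and makes
    \<open>A \<inter> level T n\<close> empty for \<open>n < s\<close>, when \<open>B\<close> may
    fail to be in \<open>F n\<close>.\<close>
  define A where "A = B \<inter> {\<omega> \<in> space M. enat s \<le> T \<omega>}"
  define w where "w n = vhat (min n s)" for n
  have w: "w n \<in> borel_measurable (F (enat n))" for n
    unfolding w_def by (rule measurable_F_mono[OF vhat_measurable_F]) simp
  have [measurable]: "T \<in> measurable M (count_space UNIV)"
    by (rule stopping_time_measurable[OF st])
  have "{\<omega> \<in> space M. enat s \<le> T \<omega>} \<in> sets M"
    by measurable
  then have AM: "A \<in> sets M"
    using B sets_F_subset unfolding A_def by blast
  have AF: "A \<inter> level T n \<in> sets (F (enat n))" for n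
  proof (cases "s \<le> n")
    case True
    then have "A \<inter> level T n = B \<inter> level T n"
      by (auto simp: A_def level_def)
    moreover have "B \<in> sets (F (enat n))"
      using B F_mono[of "enat s" "enat n"] True by auto
    ultimately show ?thesis
      using level_F[OF st] by auto
  next
    case False
    then have "A \<inter> level T n = {}"
      by (auto simp: A_def level_def)
    then show ?thesis by simp
  qed
  have AB: "(\<integral>\<^sup>+\<omega>\<in>B. f \<omega> \<partial>M) = (\<integral>\<^sup>+\<omega>\<in>A. f \<omega> \<partial>M)" for f :: "'w \<Rightarrow> ennreal"
    using stopsD(3)[OF T] by (intro nn_integral_cong_AE) (auto simp: A_def split: split_indicator)
  have w_A: "stopped w T \<omega> = vhat s \<omega>" if "T \<omega> < \<infinity>" "enat s \<le> T \<omega>" for \<omega>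
    using that by (auto simp: stopped_def w_def min_def)
  have AE_w: "(\<integral>\<^sup>+\<omega>\<in>A. f (stopped w T \<omega>) \<omega> \<partial>M) = (\<integral>\<^sup>+\<omega>\<in>A. f (vhat s \<omega>) \<omega> \<partial>M)"
    for f :: "real ^ 'k \<Rightarrow> 'w \<Rightarrow> ennreal"
    using stopsD(2,3)[OF T] by (intro nn_integral_cong_AE, eventually_elim) (simp add: w_A)
  show ?thesis
    unfolding AB
    using stopped_pythagoras[OF stops_0[OF T] AM AF w]
      AE_w[of "\<lambda>x \<omega>. ennreal ((norm (X \<omega> - x))\<^sup>2)"]
      AE_w[of "\<lambda>x \<omega>. ennreal ((norm (stopped vhat T \<omega> - x))\<^sup>2)"]
    by (simp add: sq_error_def)
qed


text \<open>Comparison with the estimator \<open>0\<close>, whose error is the second moment of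
  \<open>X\<close>.\<close>

lemma sq_error_finite: "(\<integral>\<^sup>+\<omega>. sq_error s \<omega> \<partial>M) < \<infinity>"
proof -
  have "(\<integral>\<^sup>+\<omega>\<in>space M. ennreal ((norm (X \<omega> - 0))\<^sup>2) \<partial>M) =
    (\<integral>\<^sup>+\<omega>\<in>space M. sq_error s \<omega> \<partial>M) + (\<integral>\<^sup>+\<omega>\<in>space M. ennreal ((norm (vhat s \<omega> - 0))\<^sup>2) \<partial>M)"
    unfolding sq_error_def vhat_def
    by (rule vec_cond_exp_pythagoras[OF prob_space_axioms subalgebra_F X_measurable
          X_square_integrable]) (use space_F in \<open>auto simp: sets.top[of "F (enat s)", unfolded space_F]\<close>)
  then have "(\<integral>\<^sup>+\<omega>. sq_error s \<omega> \<partial>M) \<le> (\<integral>\<^sup>+\<omega>. ennreal ((norm (X \<omega>))\<^sup>2) \<partial>M)"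
    by (simp add: nn_set_integral_space)
  also have "\<dots> < \<infinity>"
    using X_square_integrable by (simp add: integrable_iff_bounded)
  finally show ?thesis .
qed

section \<open>Gain and loss of continuing\<close>

lemma gain_measurable:
  assumes "stopping_time F T"
  shows "gain s T \<in> borel_measurable M"
proof -
  have [measurable]: "T \<in> measurable M (count_space UNIV)" "stopped vhat T \<in> borel_measurable M"
    by (intro stopping_time_measurable stopped_measurable vhat_measurable assms)+
  show ?thesis
    unfolding gain_def[abs_def] by measurable
qed

lemma loss_finite:
  assumes [measurable]: "B \<in> sets M"
  shows "(\<integral>\<^sup>+\<omega>\<in>B. loss s \<omega> \<partial>M) < \<infinity>"
proof -
  have "(\<integral>\<^sup>+\<omega>. loss s \<omega> \<partial>M) = (\<integral>\<^sup>+\<omega>. sq_error s \<omega> \<partial>M) + of_nat (N s)"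
    unfolding loss_def by (subst nn_integral_add) (auto simp: emeasure_space_1)
  also have "\<dots> < \<infinity>"
    using sq_error_finite[of s] by (simp add: of_nat_less_top)
  finally show ?thesis
    using nn_set_integral_le_space le_less_trans by blast
qed

text \<open>As \<open>N\<close> is monotone, the gain is at most the squared move of
  \<open>vhat\<close>, whose integral is bounded by the error at \<open>s\<close>. The negative part
  may have infinite integral, so the positive part is the one that gets cancelled later.\<close>

lemma gain_pos_finite:
  assumes "T \<in> stops s"
  shows "(\<integral>\<^sup>+\<omega>. ennreal (gain s T \<omega>) \<partial>M) < \<infinity>"
proof -
  have "AE \<omega> in M. ennreal (gain s T \<omega>) \<le> ennreal ((norm (stopped vhat T \<omega> - vhat s \<omega>))\<^sup>2)"
    using stopsD(2,3)[OF assms]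
  proof eventually_elim
    case (elim \<omega>)
    then have "N s \<le> N (the_enat (T \<omega>))"
      by (intro monoD[OF N_mono]) auto
    then show ?case
      by (intro ennreal_leI) (simp add: gain_def)
  qed
  then have "(\<integral>\<^sup>+\<omega>. ennreal (gain s T \<omega>) \<partial>M) \<le>
      (\<integral>\<^sup>+\<omega>. ennreal ((norm (stopped vhat T \<omega> - vhat s \<omega>))\<^sup>2) \<partial>M)"
    by (rule nn_integral_mono_AE)
  also have "\<dots> \<le> (\<integral>\<^sup>+\<omega>. sq_error s \<omega> \<partial>M)"
    using sq_error_increment[OF assms, of "space M"] sets.top[of "F (enat s)"]
    by (simp add: space_F nn_set_integral_space)
  also have "\<dots> < \<infinity>"
    by (rule sq_error_finite)
  finally show ?thesis .
qed

text \<open>Says that the difference of the losses at \<open>s\<close> and at \<open>T\<close> has the integral of the gain;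
  negative parts are moved across, so that no integrability of the stopping cost is needed.\<close>

lemma loss_gain_balance:
  assumes T: "T \<in> stops s" and B: "B \<in> sets (F (enat s))"
  shows "(\<integral>\<^sup>+\<omega>\<in>B. stopped loss T \<omega> \<partial>M) + (\<integral>\<^sup>+\<omega>\<in>B. ennreal (gain s T \<omega>) \<partial>M) =
    (\<integral>\<^sup>+\<omega>\<in>B. loss s \<omega> \<partial>M) + (\<integral>\<^sup>+\<omega>\<in>B. ennreal (- gain s T \<omega>) \<partial>M)"
proof -
  note st = stopsD(1)[OF T]
  have [measurable]: "B \<in> sets M"
    using B by (rule sets_F_subset)
  have [measurable]: "stopped loss T \<in> borel_measurable M" "stopped sq_error T \<in> borel_measurable M"
    "stopped vhat T \<in> borel_measurable M" "gain s T \<in> borel_measurable M"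
    by (intro stopped_measurable st loss_measurable sq_error_measurable vhat_measurable gain_measurable)+
  let ?a = "\<lambda>\<omega>. ennreal ((norm (stopped vhat T \<omega> - vhat s \<omega>))\<^sup>2)"
  \<comment> \<open>The definition of the gain, split into positive and negative parts, with every
    term moved to the side where it carries a plus sign.\<close>
  have "AE \<omega> in M. stopped loss T \<omega> + ennreal (gain s T \<omega>) =
      stopped sq_error T \<omega> + (?a \<omega> + (of_nat (N s) + ennreal (- gain s T \<omega>)))"
    using stopsD(2,3)[OF T]
  proof eventually_elim
    case (elim \<omega>)
    define a where "a = (norm (stopped vhat T \<omega> - vhat s \<omega>))\<^sup>2"
    define k where "k = real (N (the_enat (T \<omega>)))"
    have "0 \<le> a" "0 \<le> k"
      by (auto simp: a_def k_def)
    moreover have "gain s T \<omega> = a - (k - real (N s))"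
      by (simp add: gain_def a_def k_def)
    ultimately have "ennreal k + ennreal (gain s T \<omega>) =
        ennreal a + (ennreal (real (N s)) + ennreal (- gain s T \<omega>))"
      by (cases "0 \<le> gain s T \<omega>") (auto simp: ennreal_neg simp flip: ennreal_plus)
    then show ?case
      by (simp add: stopped_def loss_def a_def k_def ennreal_of_nat_eq_real_of_nat add.assoc)
  qed
  then have "(\<integral>\<^sup>+\<omega>\<in>B. (stopped loss T \<omega> + ennreal (gain s T \<omega>)) \<partial>M) =
      (\<integral>\<^sup>+\<omega>\<in>B. (stopped sq_error T \<omega> + (?a \<omega> + (of_nat (N s) + ennreal (- gain s T \<omega>)))) \<partial>M)"
    by (intro nn_integral_cong_AE) auto
  moreover have "(\<integral>\<^sup>+\<omega>\<in>B. loss s \<omega> \<partial>M) =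
      (\<integral>\<^sup>+\<omega>\<in>B. stopped sq_error T \<omega> \<partial>M) + (\<integral>\<^sup>+\<omega>\<in>B. ?a \<omega> \<partial>M) + (\<integral>\<^sup>+\<omega>\<in>B. of_nat (N s) \<partial>M)"
    unfolding sq_error_increment[OF T B, symmetric] loss_def
    by (simp only: distrib_right) (rule nn_integral_add; simp)
  ultimately show ?thesis
    by (simp add: distrib_right nn_integral_add add.assoc)
qed

lemma nn_integral_nn_cond_exp:
  assumes "B \<in> sets (F (enat s))" "f \<in> borel_measurable M"
  shows "(\<integral>\<^sup>+\<omega>\<in>B. nn_cond_exp M (F (enat s)) f \<omega> \<partial>M) = (\<integral>\<^sup>+\<omega>\<in>B. f \<omega> \<partial>M)"
proof -
  interpret sigma_finite_subalgebra M "F (enat s)"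
    by (rule sigma_finite_subalgebra_F)
  show ?thesis
    using nn_cond_exp_intg[of "indicator B" f] assms by (simp add: mult.commute)
qed

text \<open>Integrated over \<open>B\<close>, the conditional inequality compares the two parts of
  the gain; the balance transfers it to the losses after cancelling the finite positive
  part.\<close>

lemma loss_le_if_cond_gain_nonpos:
  assumes T: "T \<in> stops s" and B: "B \<in> sets (F (enat s))"
    and le: "AE \<omega> in M. \<omega> \<in> B \<longrightarrow> ereal_cond_exp M (F (enat s)) (gain s T) \<omega> \<le> 0"
  shows "(\<integral>\<^sup>+\<omega>\<in>B. loss s \<omega> \<partial>M) \<le> (\<integral>\<^sup>+\<omega>\<in>B. stopped loss T \<omega> \<partial>M)"
proof -
  have [measurable]: "gain s T \<in> borel_measurable M"
    using gain_measurable stopsD(1)[OF T] .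
  define p where "p = (\<integral>\<^sup>+\<omega>\<in>B. ennreal (gain s T \<omega>) \<partial>M)"
  have "p = (\<integral>\<^sup>+\<omega>\<in>B. nn_cond_exp M (F (enat s)) (\<lambda>\<omega>. ennreal (gain s T \<omega>)) \<omega> \<partial>M)"
    unfolding p_def by (rule nn_integral_nn_cond_exp[OF B, symmetric]) simp
  also have "\<dots> \<le> (\<integral>\<^sup>+\<omega>\<in>B. nn_cond_exp M (F (enat s)) (\<lambda>\<omega>. ennreal (- gain s T \<omega>)) \<omega> \<partial>M)"
    using le by (intro nn_integral_mono_AE, eventually_elim)
      (auto simp: ereal_cond_exp_def split: split_indicator intro: ereal_diff_nonpos_imp_le)
  also have "\<dots> = (\<integral>\<^sup>+\<omega>\<in>B. ennreal (- gain s T \<omega>) \<partial>M)"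
    by (rule nn_integral_nn_cond_exp[OF B]) simp
  finally have "(\<integral>\<^sup>+\<omega>\<in>B. loss s \<omega> \<partial>M) + p \<le> (\<integral>\<^sup>+\<omega>\<in>B. stopped loss T \<omega> \<partial>M) + p"
    unfolding loss_gain_balance[OF T B, folded p_def] by (rule add_left_mono)
  then have "p + (\<integral>\<^sup>+\<omega>\<in>B. loss s \<omega> \<partial>M) \<le> p + (\<integral>\<^sup>+\<omega>\<in>B. stopped loss T \<omega> \<partial>M)"
    by (simp only: add.commute[of p])
  moreover have "p < \<infinity>"
    unfolding p_def using nn_set_integral_le_space gain_pos_finite[OF T] by (rule le_less_trans)
  ultimately show ?thesis
    by (auto simp: ennreal_add_left_cancel_le)
qed

text \<open>The balance again, with strictness coming from the positive measure of \<open>B\<close>.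
  This makes switching to \<open>T\<close> on \<open>B\<close> profitable.\<close>

lemma loss_less_if_cond_gain_pos:
  assumes T: "T \<in> stops s" and B: "B \<in> sets (F (enat s))" and pos: "emeasure M B \<noteq> 0"
    and gt: "\<And>\<omega>. \<omega> \<in> B \<Longrightarrow> 0 < ereal_cond_exp M (F (enat s)) (gain s T) \<omega>"
  shows "(\<integral>\<^sup>+\<omega>\<in>B. stopped loss T \<omega> \<partial>M) < (\<integral>\<^sup>+\<omega>\<in>B. loss s \<omega> \<partial>M)"
proof -
  have [measurable]: "gain s T \<in> borel_measurable M"
    using gain_measurable stopsD(1)[OF T] .
  have BM [measurable]: "B \<in> sets M"
    using B by (rule sets_F_subset)
  define p where "p = (\<integral>\<^sup>+\<omega>\<in>B. ennreal (gain s T \<omega>) \<partial>M)"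
  define h where "h = nn_cond_exp M (F (enat s)) (\<lambda>\<omega>. ennreal (gain s T \<omega>))"
  define k where "k = nn_cond_exp M (F (enat s)) (\<lambda>\<omega>. ennreal (- gain s T \<omega>))"
  have [measurable]: "h \<in> borel_measurable M" "k \<in> borel_measurable M"
    by (simp_all add: h_def k_def)
  have p_h: "p = (\<integral>\<^sup>+\<omega>\<in>B. h \<omega> \<partial>M)"
    unfolding p_def h_def by (rule nn_integral_nn_cond_exp[OF B, symmetric]) simp
  have p_fin: "p < \<infinity>"
    unfolding p_def using nn_set_integral_le_space gain_pos_finite[OF T] by (rule le_less_trans)
  \<comment> \<open>Finiteness of \<open>h\<close> on \<open>B\<close> excludes
    \<open>\<infinity> - \<infinity> = \<infinity>\<close>, which would count as a positive gain
    without \<open>k < h\<close>.\<close>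
  have "AE \<omega> in M. h \<omega> * indicator B \<omega> \<noteq> \<infinity>"
    using p_fin unfolding p_h by (intro nn_integral_PInf_AE) auto
  then have less: "AE \<omega> in M. \<omega> \<in> B \<longrightarrow> k \<omega> < h \<omega>"
  proof eventually_elim
    case (elim \<omega>)
    show ?case
    proof
      assume "\<omega> \<in> B"
      with elim gt[of \<omega>] show "k \<omega> < h \<omega>"
        by (simp add: ereal_cond_exp_def ereal_diff_pos_iff flip: h_def k_def)
    qed
  qed
  have k_le: "AE \<omega> in M. k \<omega> * indicator B \<omega> \<le> h \<omega> * indicator B \<omega>"
    using less by eventually_elim (auto split: split_indicator)
  have "(\<integral>\<^sup>+\<omega>\<in>B. ennreal (- gain s T \<omega>) \<partial>M) = (\<integral>\<^sup>+\<omega>\<in>B. k \<omega> \<partial>M)"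
    unfolding k_def by (rule nn_integral_nn_cond_exp[OF B, symmetric]) simp
  also have "\<dots> < (\<integral>\<^sup>+\<omega>\<in>B. h \<omega> \<partial>M)"
  proof (rule nn_integral_less[OF _ _ _ k_le])
    show "(\<integral>\<^sup>+\<omega>\<in>B. k \<omega> \<partial>M) \<noteq> \<infinity>"
      using nn_integral_mono_AE[OF k_le] p_fin unfolding p_h by (auto simp: top_unique)
    show "\<not> (AE \<omega> in M. h \<omega> * indicator B \<omega> \<le> k \<omega> * indicator B \<omega>)"
    proof
      assume "AE \<omega> in M. h \<omega> * indicator B \<omega> \<le> k \<omega> * indicator B \<omega>"
      with less have "AE \<omega> in M. \<omega> \<notin> B"
        by eventually_elim (auto split: split_indicator_asm)
      then show False
        using pos BM by (simp add: AE_iff_null_sets[symmetric] null_sets_def)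
    qed
  qed auto
  finally have "(\<integral>\<^sup>+\<omega>\<in>B. ennreal (- gain s T \<omega>) \<partial>M) < p"
    by (simp add: p_h)
  then have "(\<integral>\<^sup>+\<omega>\<in>B. loss s \<omega> \<partial>M) + (\<integral>\<^sup>+\<omega>\<in>B. ennreal (- gain s T \<omega>) \<partial>M) < (\<integral>\<^sup>+\<omega>\<in>B. loss s \<omega> \<partial>M) + p"
    using loss_finite[OF BM, of s] by (simp add: ennreal_add_left_cancel_less)
  then have "p + (\<integral>\<^sup>+\<omega>\<in>B. stopped loss T \<omega> \<partial>M) < p + (\<integral>\<^sup>+\<omega>\<in>B. loss s \<omega> \<partial>M)"
    unfolding loss_gain_balance[OF T B, folded p_def, symmetric] by (simp only: add.commute[of p])
  then show ?thesis
    by (simp add: ennreal_add_left_cancel_less)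
qed

section \<open>Comparison of stopping times level by level\<close>

text \<open>Reduces to a deterministic starting time: on \<open>level T n\<close>, \<open>S\<close>
  agrees almost everywhere with its maximum with \<open>n\<close>, which is a member of
  \<open>stops n\<close>.\<close>

lemma stopped_integral_le:
  assumes T: "T \<in> stops 0" and S: "S \<in> stops 0" and TS: "AE \<omega> in M. T \<omega> \<le> S \<omega>"
    and \<phi>: "\<And>n. \<phi> n \<in> borel_measurable M"
    and le: "\<And>n S'. S' \<in> stops n \<Longrightarrow> (\<integral>\<^sup>+\<omega>\<in>level T n. \<phi> n \<omega> \<partial>M) \<le> (\<integral>\<^sup>+\<omega>\<in>level T n. stopped \<phi> S' \<omega> \<partial>M)"
  shows "(\<integral>\<^sup>+\<omega>. stopped \<phi> T \<omega> \<partial>M) \<le> (\<integral>\<^sup>+\<omega>. stopped \<phi> S \<omega> \<partial>M)"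
proof -
  have "(\<integral>\<^sup>+\<omega>\<in>level T n. stopped \<phi> T \<omega> \<partial>M) \<le> (\<integral>\<^sup>+\<omega>\<in>level T n. stopped \<phi> S \<omega> \<partial>M)" for n
  proof -
    have "(\<integral>\<^sup>+\<omega>\<in>level T n. stopped \<phi> T \<omega> \<partial>M) = (\<integral>\<^sup>+\<omega>\<in>level T n. \<phi> n \<omega> \<partial>M)"
      by (intro nn_integral_cong) (auto simp: stopped_level split: split_indicator)
    also have "\<dots> \<le> (\<integral>\<^sup>+\<omega>\<in>level T n. stopped \<phi> (\<lambda>\<omega>. max (S \<omega>) (enat n)) \<omega> \<partial>M)"
      by (rule le[OF max_stops[OF S]])
    also have "\<dots> = (\<integral>\<^sup>+\<omega>\<in>level T n. stopped \<phi> S \<omega> \<partial>M)"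
      using TS by (intro nn_integral_cong_AE, eventually_elim)
        (auto simp: stopped_def level_def max_absorb1 split: split_indicator)
    finally show ?thesis .
  qed
  moreover have "(\<integral>\<^sup>+\<omega>. stopped \<phi> R \<omega> \<partial>M) = (\<Sum>n. \<integral>\<^sup>+\<omega>\<in>level T n. stopped \<phi> R \<omega> \<partial>M)"
    if "R \<in> stops 0" for R
    using that by (intro nn_integral_levels[OF T] stopped_measurable stopsD(1) \<phi>)
  ultimately show ?thesis
    using T S by (simp add: suminf_le)
qed

lemma stopped_sq_error_antimono:
  assumes T: "T \<in> stops 0" and S: "S \<in> stops 0" and TS: "\<And>\<omega>. T \<omega> \<le> S \<omega>"
  shows "(\<integral>\<^sup>+\<omega>. stopped sq_error S \<omega> \<partial>M) \<le> (\<integral>\<^sup>+\<omega>. stopped sq_error T \<omega> \<partial>M)"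
proof -
  have "(\<integral>\<^sup>+\<omega>\<in>level T n. stopped sq_error S \<omega> \<partial>M) \<le> (\<integral>\<^sup>+\<omega>\<in>level T n. stopped sq_error T \<omega> \<partial>M)" for n
  proof -
    have "(\<integral>\<^sup>+\<omega>\<in>level T n. stopped sq_error S \<omega> \<partial>M) =
        (\<integral>\<^sup>+\<omega>\<in>level T n. stopped sq_error (\<lambda>\<omega>. max (S \<omega>) (enat n)) \<omega> \<partial>M)"
    proof (intro nn_integral_cong)
      fix \<omega>
      show "stopped sq_error S \<omega> * indicator (level T n) \<omega> =
          stopped sq_error (\<lambda>\<omega>. max (S \<omega>) (enat n)) \<omega> * indicator (level T n) \<omega>"
        using TS[of \<omega>] by (auto simp: stopped_def level_def max_absorb1 split: split_indicator)
    qed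
    also have "\<dots> \<le> (\<integral>\<^sup>+\<omega>\<in>level T n. sq_error n \<omega> \<partial>M)"
      unfolding sq_error_increment[OF max_stops[OF S] level_F[OF stopsD(1)[OF T]]] by simp
    also have "\<dots> = (\<integral>\<^sup>+\<omega>\<in>level T n. stopped sq_error T \<omega> \<partial>M)"
      by (intro nn_integral_cong) (auto simp: stopped_level split: split_indicator)
    finally show ?thesis .
  qed
  moreover have "(\<integral>\<^sup>+\<omega>. stopped sq_error R \<omega> \<partial>M) = (\<Sum>n. \<integral>\<^sup>+\<omega>\<in>level T n. stopped sq_error R \<omega> \<partial>M)"
    if "R \<in> stops 0" for R
    using that by (intro nn_integral_levels[OF T] stopped_measurable stopsD(1) sq_error_measurable)
  ultimately show ?thesis
    using T S by (simp add: suminf_le)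
qed

end

section \<open>The first zero of a sequence\<close>

text \<open>A nonempty set of extended naturals contains its infimum, and a finite infimum excludes
  the empty set.\<close>

lemma first_zero_eqD: "first_zero Y \<omega> = enat n \<Longrightarrow> Y n \<omega> = 0"
proof -
  assume "first_zero Y \<omega> = enat n"
  then have eq: "Inf {enat s | s. Y s \<omega> = 0} = enat n"
    by (simp add: first_zero_def)
  then have "{enat s | s. Y s \<omega> = 0} \<noteq> {}"
    by (metis Inf_enat_def enat.distinct(1))
  then have "Inf {enat s | s. Y s \<omega> = 0} \<in> {enat s | s. Y s \<omega> = 0}"
    unfolding Inf_enat_def by (auto intro: LeastI)
  then show ?thesis
    unfolding eq by auto
qed

lemma first_zero_le: "Y n \<omega> = 0 \<Longrightarrow> first_zero Y \<omega> \<le> enat n"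
  unfolding first_zero_def by (rule Inf_lower) auto

lemma first_zero_le_iff: "first_zero Y \<omega> \<le> enat n \<longleftrightarrow> (\<exists>s\<le>n. Y s \<omega> = 0)"
proof
  assume le: "first_zero Y \<omega> \<le> enat n"
  then obtain s where "first_zero Y \<omega> = enat s"
    by (cases "first_zero Y \<omega>") auto
  with le show "\<exists>s\<le>n. Y s \<omega> = 0"
    by (intro exI[of _ s]) (auto dest: first_zero_eqD)
next
  assume "\<exists>s\<le>n. Y s \<omega> = 0"
  then show "first_zero Y \<omega> \<le> enat n"
    by (meson first_zero_le enat_ord_simps(1) order_trans)
qed

context stopped_estimation
begin

section \<open>Risk and increasing limits of stopping times\<close>

text \<open>The value at \<open>\<infinity>\<close> is the limit of the unbounded \<open>N\<close>,
  so the stopping cost commutes with increasing suprema and detects infinite times.\<close>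

definition N_ext :: "enat \<Rightarrow> ennreal" where
  "N_ext x = (case x of enat n \<Rightarrow> of_nat (N n) | \<infinity> \<Rightarrow> \<infinity>)"

lemma N_ext_mono: "mono N_ext"
  using N_mono by (auto simp: mono_def N_ext_def split: enat.split)

lemma N_ext_SUP: "N_ext (SUP i::nat. T i) = (SUP i. N_ext (T i))"
proof (rule antisym)
  have N_le: "of_nat (N n) \<le> (SUP i. N_ext (T i))" if le: "enat n \<le> (SUP i. T i)" for n
  proof -
    obtain i where "enat n \<le> T i"
      using ex_le_SUP_enat[OF le] by blast
    then have "N_ext (enat n) \<le> N_ext (T i)"
      by (rule monoD[OF N_ext_mono])
    then show ?thesis
      by (auto simp: N_ext_def intro: SUP_upper2)
  qed
  show "N_ext (SUP i. T i) \<le> (SUP i. N_ext (T i))"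
  proof (cases "SUP i. T i")
    case (enat n)
    then show ?thesis
      using N_le[of n] by (simp add: N_ext_def)
  next
    case infinity
    have "of_nat K \<le> (SUP i. N_ext (T i))" for K
    proof -
      obtain n where "K \<le> N n"
        using N_unbounded by blast
      then have "(of_nat K :: ennreal) \<le> of_nat (N n)"
        by simp
      also have "\<dots> \<le> (SUP i. N_ext (T i))"
        using infinity by (intro N_le) simp
      finally show ?thesis .
    qed
    then have "(SUP K. of_nat K :: ennreal) \<le> (SUP i. N_ext (T i))"
      by (intro SUP_least)
    then show ?thesis
      unfolding ennreal_SUP_of_nat_eq_top by (metis top_greatest top_unique)
  qed
  show "(SUP i. N_ext (T i)) \<le> N_ext (SUP i. T i)"
    by (intro SUP_least monoD[OF N_ext_mono] SUP_upper) auto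
qed

text \<open>The \<open>J(T)\<close> of the outline.\<close>

definition risk :: "('w \<Rightarrow> enat) \<Rightarrow> ennreal" where
  "risk T = (\<integral>\<^sup>+\<omega>. stopped loss T \<omega> \<partial>M)"

lemma N_ext_comp_measurable:
  assumes "stopping_time F T"
  shows "(\<lambda>\<omega>. N_ext (T \<omega>)) \<in> borel_measurable M"
  by (rule measurable_compose[OF stopping_time_measurable[OF assms]]) simp

text \<open>Separates the part that decreases as \<open>T\<close> grows from the part that passes to
  limits by monotone convergence.\<close>

lemma risk_eq:
  assumes T: "T \<in> stops 0"
  shows "risk T = (\<integral>\<^sup>+\<omega>. stopped sq_error T \<omega> \<partial>M) + (\<integral>\<^sup>+\<omega>. N_ext (T \<omega>) \<partial>M)"
proof -
  note st = stopsD(1)[OF T]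
  have "risk T = (\<integral>\<^sup>+\<omega>. (stopped sq_error T \<omega> + N_ext (T \<omega>)) \<partial>M)"
    unfolding risk_def using stopsD(2)[OF T]
    by (intro nn_integral_cong_AE, eventually_elim) (auto simp: stopped_def loss_def N_ext_def)
  also have "\<dots> = (\<integral>\<^sup>+\<omega>. stopped sq_error T \<omega> \<partial>M) + (\<integral>\<^sup>+\<omega>. N_ext (T \<omega>) \<partial>M)"
    by (intro nn_integral_add stopped_measurable[OF st] sq_error_measurable N_ext_comp_measurable[OF st])
  finally show ?thesis .
qed

text \<open>The common bound on the risks bounds the mean stopping cost of the supremum; as
  \<open>N_ext\<close> is infinite at \<open>\<infinity>\<close>, the supremum is almost surely
  finite.\<close>

lemma SUP_stops:
  assumes T: "\<And>n::nat. T n \<in> stops 0" and inc: "\<And>n \<omega>. T n \<omega> \<le> T (Suc n) \<omega>"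
    and bnd: "\<And>n. risk (T n) \<le> K" and K: "K < \<infinity>"
  shows "(\<lambda>\<omega>. SUP n. T n \<omega>) \<in> stops 0"
    "(\<integral>\<^sup>+\<omega>. N_ext (SUP n. T n \<omega>) \<partial>M) = (SUP n. \<integral>\<^sup>+\<omega>. N_ext (T n \<omega>) \<partial>M)"
proof -
  note st = stopsD(1)[OF T]
  have "incseq (\<lambda>n \<omega>. N_ext (T n \<omega>))"
    by (intro incseq_SucI) (auto intro!: le_funI monoD[OF N_ext_mono] inc)
  then show int: "(\<integral>\<^sup>+\<omega>. N_ext (SUP n. T n \<omega>) \<partial>M) = (SUP n. \<integral>\<^sup>+\<omega>. N_ext (T n \<omega>) \<partial>M)"
    unfolding N_ext_SUP by (rule nn_integral_monotone_convergence_SUP) (rule N_ext_comp_measurable[OF st])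
  have S: "stopping_time F (\<lambda>\<omega>. SUP n. T n \<omega>)"
    unfolding stopping_time_def SUP_le_iff
    using stopping_timeD[OF st] by (auto intro!: pred_intros_countable)
  have "(SUP n. \<integral>\<^sup>+\<omega>. N_ext (T n \<omega>) \<partial>M) \<le> K"
  proof (rule SUP_least)
    fix n
    have "(\<integral>\<^sup>+\<omega>. N_ext (T n \<omega>) \<partial>M) \<le> risk (T n)"
      unfolding risk_eq[OF T] by simp
    then show "(\<integral>\<^sup>+\<omega>. N_ext (T n \<omega>) \<partial>M) \<le> K"
      using bnd order_trans by blast
  qed
  then have "AE \<omega> in M. N_ext (SUP n. T n \<omega>) \<noteq> \<infinity>"
    using K int
    by (intro nn_integral_PInf_AE N_ext_comp_measurable[OF S]) (metis le_less_trans infinity_ennreal_def less_irrefl)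
  then have "AE \<omega> in M. (SUP n. T n \<omega>) < \<infinity>"
    by eventually_elim (auto simp: N_ext_def split: enat.splits)
  with S show "(\<lambda>\<omega>. SUP n. T n \<omega>) \<in> stops 0"
    by (simp add: stop_times_def zero_enat_def[symmetric])
qed

section \<open>Unimprovable continuations\<close>

lemma near_optimal_continuation:
  fixes \<epsilon> :: real
  assumes T: "T \<in> stops 0" and fin: "risk T < \<infinity>" and \<epsilon>: "0 < \<epsilon>"
  shows "\<exists>T'\<in>stops 0. T \<le> T' \<and> risk T' \<le> risk T \<and> (\<forall>S\<in>stops 0. T \<le> S \<longrightarrow> risk T' \<le> risk S + \<epsilon>)"
proof -
  define C where "C = {S \<in> stops 0. T \<le> S}"
  define m where "m = (INF S\<in>C. risk S)"
  have "T \<in> C"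
    using T by (simp add: C_def)
  then have "m \<le> risk T"
    unfolding m_def by (rule INF_lower)
  then have "m < m + ennreal \<epsilon>"
    using fin \<epsilon> ennreal_add_left_cancel_less[of m 0 "ennreal \<epsilon>"] by auto
  then obtain S where S: "S \<in> C" "risk S < m + ennreal \<epsilon>"
    unfolding m_def by (auto simp: INF_less_iff)
  have m: "m + \<epsilon> \<le> risk S' + \<epsilon>" if "S' \<in> stops 0" "T \<le> S'" for S'
    using that unfolding m_def C_def by (intro add_right_mono INF_lower) auto
  show ?thesis
  proof (cases "risk S \<le> risk T")
    case True
    then show ?thesis
      using S m by (intro bexI[of _ S]) (auto simp: C_def intro: order_trans less_imp_le)
  next
    \<comment> \<open>If the \<epsilon>-minimizer \<open>S\<close> is worse than \<open>T\<close>,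
      then \<open>T\<close> itself is within \<epsilon> of the infimum and is chosen
      instead.\<close>
    case False
    then have "risk T \<le> m + ennreal \<epsilon>"
      using S(2) by simp
    then show ?thesis
      using T m by (intro bexI[of _ T]) (auto intro: order_trans)
  qed
qed

text \<open>The supremum of an increasing sequence of ever better continuations. Along such a sequence the
  estimation error decreases and the stopping cost converges monotonically, so that passing to the
  limit needs no uniform integrability.\<close>

lemma unimprovable_continuation_exists:
  assumes T0: "T0 \<in> stops 0" and fin: "risk T0 < \<infinity>"
  shows "\<exists>S\<in>stops 0. risk S \<le> risk T0 \<and> (\<forall>S'\<in>stops 0. S \<le> S' \<longrightarrow> risk S \<le> risk S')"
proof -
  define P where "P T \<longleftrightarrow> T \<in> stops 0 \<and> risk T \<le> risk T0" for T
  \<comment> \<open>\<open>T'\<close> is within \<open>1 / Suc n\<close> of the best continuation of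
    \<open>T\<close>; the tolerances shrink to \<open>0\<close> along the sequence.\<close>
  define Q where "Q n T T' \<longleftrightarrow> T \<le> T' \<and>
    (\<forall>S\<in>stops 0. T \<le> S \<longrightarrow> risk T' \<le> risk S + ennreal (1 / real (Suc n)))" for n T T'
  have "\<exists>T. P T"
    using T0 by (auto simp: P_def)
  moreover have "\<exists>T'. P T' \<and> Q n T T'" if "P T" for n T
    using near_optimal_continuation[of T "1 / real (Suc n)"] that fin
    by (auto simp: P_def Q_def intro: le_less_trans order_trans)
  ultimately obtain T where T: "\<And>n. P (T n)" and Q: "\<And>n. Q n (T n) (T (Suc n))"
    using dependent_nat_choice[of "\<lambda>_. P" Q] by metis
  have Tst: "T n \<in> stops 0" and Tle: "risk (T n) \<le> risk T0" for n
    using T by (auto simp: P_def)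
  have inc: "T n \<le> T (Suc n)" for n
    using Q by (auto simp: Q_def)
  define S where "S \<omega> = (SUP n. T n \<omega>)" for \<omega>
  note SUP = SUP_stops[of T, OF Tst le_funD[OF inc] Tle fin, folded S_def]
  have S: "S \<in> stops 0"
    using SUP(1) by simp
  have TS: "T n \<le> S" for n
    by (auto simp: S_def le_fun_def intro: SUP_upper)
  define e where "e = (\<integral>\<^sup>+\<omega>. stopped sq_error S \<omega> \<partial>M)"
  define c where "c n = (\<integral>\<^sup>+\<omega>. N_ext (T n \<omega>) \<partial>M)" for n
  have c_mono: "c n \<le> c k" if "n \<le> k" for n k
  proof -
    have "T n \<le> T k"
      using that inc by (rule lift_Suc_mono_le[rotated])
    then show ?thesis
      unfolding c_def by (intro nn_integral_mono monoD[OF N_ext_mono]) (auto simp: le_fun_def)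
  qed
  \<comment> \<open>The error part \<open>e\<close> already belongs to the limit \<open>S\<close>
    and only the cost part is a supremum, so it suffices to bound each
    \<open>e + c n\<close>.\<close>
  have risk_S: "risk S = (SUP n. e + c n)"
    unfolding risk_eq[OF S] e_def[symmetric] SUP(2) c_def[symmetric]
    by (simp add: ennreal_SUP_add_left add.commute[of e])
  have risk_T: "e + c n \<le> risk (T n)" for n
    unfolding risk_eq[OF Tst] e_def c_def
    using stopped_sq_error_antimono[OF Tst S le_funD[OF TS]] by (intro add_mono) auto
  have "risk S \<le> risk T0"
    unfolding risk_S by (intro SUP_least order_trans[OF risk_T Tle])
  moreover have "risk S \<le> risk S'" if S': "S' \<in> stops 0" "S \<le> S'" for S'
    unfolding risk_S
  proof (rule SUP_least, rule ennreal_le_epsilon)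
    fix n and \<epsilon> :: real assume "0 < \<epsilon>"
    then obtain k where k: "1 / real (Suc k) < \<epsilon>"
      using nat_approx_posE by blast
    \<comment> \<open>\<open>i \<ge> n\<close> gives \<open>c n \<le> c (Suc i)\<close>, and
      \<open>i \<ge> k\<close> brings the tolerance below \<epsilon>.\<close>
    define i where "i = max n k"
    have "1 / real (Suc i) \<le> 1 / real (Suc k)"
      by (intro divide_left_mono) (auto simp: i_def)
    then have i: "1 / real (Suc i) \<le> \<epsilon>"
      using k by linarith
    have "e + c n \<le> e + c (Suc i)"
      by (intro add_left_mono c_mono) (simp add: i_def)
    also have "\<dots> \<le> risk (T (Suc i))"
      by (rule risk_T)
    \<comment> \<open>\<open>S'\<close> lies above \<open>S\<close>, hence above \<open>T i\<close>,
      so it competes with the choice \<open>T (Suc i)\<close>.\<close>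
    also have "\<dots> \<le> risk S' + ennreal (1 / real (Suc i))"
      using Q[of i] S' TS[of i] by (auto simp: Q_def)
    also have "\<dots> \<le> risk S' + ennreal \<epsilon>"
      using i by (intro add_left_mono ennreal_leI)
    finally show "e + c n \<le> risk S' + ennreal \<epsilon>" .
  qed
  ultimately show ?thesis
    using S by blast
qed

text \<open>Otherwise switching from \<open>S\<close> to \<open>T\<close> where \<open>S = s\<close>
  and the conditional gain is positive would give a continuation of strictly smaller risk.\<close>

lemma unimprovable_cond_gain_nonpos:
  assumes S: "S \<in> stops 0" and fin: "risk S < \<infinity>"
    and unimprovable: "\<And>S'. S' \<in> stops 0 \<Longrightarrow> S \<le> S' \<Longrightarrow> risk S \<le> risk S'"
    and T: "T \<in> stops s"
  shows "AE \<omega> in M. S \<omega> = enat s \<longrightarrow> ereal_cond_exp M (F (enat s)) (gain s T) \<omega> \<le> 0"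
proof -
  let ?ce = "ereal_cond_exp M (F (enat s)) (gain s T)"
  have [measurable]: "?ce \<in> borel_measurable (F (enat s))"
    by (rule borel_measurable_ereal_cond_exp)
  define B where "B = level S s \<inter> {\<omega> \<in> space (F (enat s)). 0 < ?ce \<omega>}"
  have B: "B \<in> sets (F (enat s))"
    unfolding B_def using level_F[OF stopsD(1)[OF S]] by auto
  then have BM [measurable]: "B \<in> sets M"
    by (rule sets_F_subset)
  have B_eq: "B = {\<omega> \<in> space M. \<not> (S \<omega> = enat s \<longrightarrow> ?ce \<omega> \<le> 0)}"
    by (auto simp: B_def level_def space_F not_le)
  have "emeasure M B = 0"
  proof (rule ccontr)
    assume pos: "emeasure M B \<noteq> 0"
    \<comment> \<open>\<open>T\<close> is at least \<open>s\<close> only almost surely;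
      \<open>S \<le> R\<close> and the stopping time property before \<open>s\<close> call for a
      pointwise bound.\<close>
    define T1 where "T1 \<omega> = max (T \<omega>) (enat s)" for \<omega>
    have T1: "T1 \<in> stops s"
      unfolding T1_def using max_stops[OF stops_0[OF T]] .
    define R where "R \<omega> = (if \<omega> \<in> B then T1 \<omega> else S \<omega>)" for \<omega>
    have B_S: "S \<omega> = enat s" if "\<omega> \<in> B" for \<omega>
      using that by (simp add: B_def level_def)
    have SR: "S \<le> R"
      by (auto simp: le_fun_def R_def T1_def B_S)
    have "stopping_time F R"
    proof (rule stopping_timeI)
      fix t
      show "Measurable.pred (F t) (\<lambda>\<omega>. R \<omega> \<le> t)"
      \<comment> \<open>From time \<open>s\<close> on, \<open>B\<close> is in \<open>F t\<close> and
        may decide between the two times; before \<open>s\<close>, \<open>R \<le> t\<close> and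
        \<open>S \<le> t\<close> are the same event.\<close>
      proof (cases "enat s \<le> t")
        case True
        then have "B \<in> sets (F t)"
          using B F_mono by blast
        then show ?thesis
          unfolding R_def using stopping_timeD[OF stopsD(1)[OF T1], of t] stopping_timeD[OF stopsD(1)[OF S], of t]
          by (auto intro!: measurable_If_set simp: if_distrib[where f = "\<lambda>x. x \<le> t"] space_F)
      next
        case False
        then have "R \<omega> \<le> t \<longleftrightarrow> S \<omega> \<le> t" for \<omega>
          by (auto simp: R_def T1_def B_S)
        then show ?thesis
          using stopping_timeD[OF stopsD(1)[OF S], of t] by simp
      qed
    qed
    moreover have "AE \<omega> in M. R \<omega> < \<infinity>"
      using stopsD(2)[OF T1] stopsD(2)[OF S] by eventually_elim (auto simp: R_def)
    ultimately have R: "R \<in> stops 0"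
      by (simp add: stop_times_def zero_enat_def[symmetric])
    have split: "risk U = (\<integral>\<^sup>+\<omega>\<in>B. stopped loss U \<omega> \<partial>M) + (\<integral>\<^sup>+\<omega>\<in>space M - B. stopped loss U \<omega> \<partial>M)"
      if "U \<in> stops 0" for U
    proof -
      have [measurable]: "stopped loss U \<in> borel_measurable M"
        by (intro stopped_measurable stopsD(1)[OF that] loss_measurable)
      have "risk U = (\<integral>\<^sup>+\<omega>\<in>B \<union> (space M - B). stopped loss U \<omega> \<partial>M)"
        unfolding risk_def by (intro nn_integral_cong) auto
      also have "\<dots> = (\<integral>\<^sup>+\<omega>\<in>B. stopped loss U \<omega> \<partial>M) + (\<integral>\<^sup>+\<omega>\<in>space M - B. stopped loss U \<omega> \<partial>M)"
        by (rule nn_integral_disjoint_pair) auto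
      finally show ?thesis .
    qed
    have out: "(\<integral>\<^sup>+\<omega>\<in>space M - B. stopped loss R \<omega> \<partial>M) = (\<integral>\<^sup>+\<omega>\<in>space M - B. stopped loss S \<omega> \<partial>M)"
      by (intro nn_integral_cong) (auto simp: stopped_def R_def split: split_indicator)
    have "(\<integral>\<^sup>+\<omega>\<in>B. stopped loss R \<omega> \<partial>M) = (\<integral>\<^sup>+\<omega>\<in>B. stopped loss T \<omega> \<partial>M)"
      using stopsD(3)[OF T] by (intro nn_integral_cong_AE, eventually_elim)
        (auto simp: stopped_def R_def T1_def max_absorb1 split: split_indicator)
    also have "\<dots> < (\<integral>\<^sup>+\<omega>\<in>B. loss s \<omega> \<partial>M)"
      by (rule loss_less_if_cond_gain_pos[OF T B pos]) (simp add: B_def)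
    also have "\<dots> = (\<integral>\<^sup>+\<omega>\<in>B. stopped loss S \<omega> \<partial>M)"
      by (intro nn_integral_cong) (auto simp: stopped_def B_S split: split_indicator)
    \<comment> \<open>The integrals outside \<open>B\<close> coincide and are finite as
      \<open>risk S\<close> is, so strictness survives adding them.\<close>
    finally have "risk R < risk S"
      using fin unfolding split[OF R] split[OF S] out
      unfolding add.commute[of _ "\<integral>\<^sup>+\<omega>\<in>space M - B. stopped loss S \<omega> \<partial>M"]
      by (auto simp: ennreal_add_left_cancel_less)
    then show False
      using unimprovable[OF R SR] by simp
  qed
  then show ?thesis
    using BM B_eq by (subst AE_iff_measurable[of B]) auto
qed

section \<open>Optimality of the first zero\<close>

text \<open>The constant time \<open>s\<close> has gain \<open>0\<close>, giving
  \<open>Y \<ge> 0\<close>; the reverse follows from minimality of \<open>Y\<close> among upper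
  bounds.\<close>

lemma ess_sup_gain_zero:
  assumes S: "S \<in> stops 0" and fin: "risk S < \<infinity>"
    and unimprovable: "\<And>S'. S' \<in> stops 0 \<Longrightarrow> S \<le> S' \<Longrightarrow> risk S \<le> risk S'"
    and Y: "is_ess_sup M (F (enat s)) {ereal_cond_exp M (F (enat s)) (gain s T) | T. T \<in> stops s} Y"
  shows "AE \<omega> in M. S \<omega> = enat s \<longrightarrow> Y \<omega> = 0"
proof -
  interpret sigma_finite_subalgebra M "F (enat s)"
    by (rule sigma_finite_subalgebra_F)
  have ge: "AE \<omega> in M. 0 \<le> Y \<omega>"
  proof -
    have "gain s (\<lambda>_. enat s) \<omega> = 0" for \<omega>
      by (simp add: gain_def stopped_def)
    then have "AE \<omega> in M. ereal_cond_exp M (F (enat s)) (gain s (\<lambda>_. enat s)) \<omega> = 0"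
      using nn_cond_exp_F_meas[of "\<lambda>_. 0"] by (auto simp: ereal_cond_exp_def elim!: eventually_mono)
    moreover have "AE \<omega> in M. ereal_cond_exp M (F (enat s)) (gain s (\<lambda>_. enat s)) \<omega> \<le> Y \<omega>"
      using Y const_stops by (auto simp: is_ess_sup_def)
    ultimately show ?thesis
      by eventually_elim simp
  qed
  \<comment> \<open>The conditional gains are controlled only where \<open>S = s\<close>, so the
    upper bound to be compared with \<open>Y\<close> is infinite elsewhere.\<close>
  define Z where "Z \<omega> = (if \<omega> \<in> level S s then 0 else \<infinity> :: ereal)" for \<omega>
  have [measurable]: "level S s \<in> sets M"
    using level_sets stopsD(1)[OF S] .
  have "Z \<in> borel_measurable M"
    unfolding Z_def by measurable
  moreover have "AE \<omega> in M. ereal_cond_exp M (F (enat s)) (gain s T) \<omega> \<le> Z \<omega>" if "T \<in> stops s" for T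
    using unimprovable_cond_gain_nonpos[of S, OF S fin unimprovable that, simplified]
    by eventually_elim (auto simp: Z_def level_def)
  ultimately have "AE \<omega> in M. Y \<omega> \<le> Z \<omega>"
    using Y by (auto simp: is_ess_sup_def)
  with ge show ?thesis
    using AE_space by eventually_elim (auto simp: Z_def level_def)
qed

theorem first_zero_optimal:
  assumes Y: "\<And>s. is_ess_sup M (F (enat s)) {ereal_cond_exp M (F (enat s)) (gain s T) | T. T \<in> stops s} (Y s)"
  shows "first_zero Y \<in> stops 0" "\<And>T. T \<in> stops 0 \<Longrightarrow> risk (first_zero Y) \<le> risk T"
proof -
  let ?\<tau> = "first_zero Y"
  have Y_F: "Y s \<in> borel_measurable (F (enat s))" for s
    using Y[of s] by (simp add: is_ess_sup_def)
  have st: "stopping_time F ?\<tau>"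
  proof (rule stopping_timeI)
    fix t
    show "Measurable.pred (F t) (\<lambda>\<omega>. ?\<tau> \<omega> \<le> t)"
    proof (cases t)
      case (enat n)
      have "Measurable.pred (F (enat n)) (\<lambda>\<omega>. \<exists>s\<in>{..n}. Y s \<omega> = 0)"
      proof (intro pred_intros_finite)
        fix s assume "s \<in> {..n}"
        then have [measurable]: "Y s \<in> borel_measurable (F (enat n))"
          by (intro measurable_F_mono[OF Y_F]) simp
        show "Measurable.pred (F (enat n)) (\<lambda>\<omega>. Y s \<omega> = 0)"
          by measurable
      qed simp
      then show ?thesis
        unfolding enat first_zero_le_iff by (simp only: Bex_def atMost_iff)
    qed simp
  qed
  have le_unimprovable: "AE \<omega> in M. ?\<tau> \<omega> \<le> S \<omega>"
    if "S \<in> stops 0" "risk S < \<infinity>" "\<And>S'. S' \<in> stops 0 \<Longrightarrow> S \<le> S' \<Longrightarrow> risk S \<le> risk S'" for S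
  proof -
    \<comment> \<open>Quantified over all \<open>s\<close> at once, so that it may be used at the
      random time \<open>S \<omega>\<close>.\<close>
    have "AE \<omega> in M. \<forall>s. S \<omega> = enat s \<longrightarrow> Y s \<omega> = 0"
      unfolding AE_all_countable
    proof
      fix s
      show "AE \<omega> in M. S \<omega> = enat s \<longrightarrow> Y s \<omega> = 0"
        by (rule ess_sup_gain_zero[OF _ _ _ Y]) (use that in auto)
    qed
    then show ?thesis
      using stopsD(2)[OF that(1)] by eventually_elim (auto intro: first_zero_le)
  qed
  have unimprovable: "\<exists>S\<in>stops 0. risk S \<le> risk T \<and> (AE \<omega> in M. ?\<tau> \<omega> \<le> S \<omega>)"
    if T: "T \<in> stops 0" "risk T < \<infinity>" for T
  proof -
    obtain S where S: "S \<in> stops 0" "risk S \<le> risk T"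
      "\<And>S'. S' \<in> stops 0 \<Longrightarrow> S \<le> S' \<Longrightarrow> risk S \<le> risk S'"
      using unimprovable_continuation_exists[OF T] by blast
    then show ?thesis
      using le_unimprovable[OF S(1) le_less_trans[OF S(2) T(2)] S(3)] by blast
  qed
  \<comment> \<open>Stopping at \<open>0\<close> has finite risk, so some almost surely finite
    \<open>S\<close> bounds \<open>?\<tau>\<close>.\<close>
  have "risk (\<lambda>_. enat 0) < \<infinity>"
    using loss_finite[of "space M" 0] by (simp add: risk_def stopped_def nn_set_integral_space)
  then obtain S where S: "S \<in> stops 0" "AE \<omega> in M. ?\<tau> \<omega> \<le> S \<omega>"
    using unimprovable const_stops by blast
  from S(2) stopsD(2)[OF S(1)] have "AE \<omega> in M. ?\<tau> \<omega> < \<infinity>"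
    by eventually_elim (rule le_less_trans)
  with st show \<tau>: "?\<tau> \<in> stops 0"
    by (simp add: stop_times_def zero_enat_def[symmetric])
  show "risk ?\<tau> \<le> risk T" if T: "T \<in> stops 0" for T
  proof (cases "risk T < \<infinity>")
    case False
    then show ?thesis by (simp add: less_top[symmetric])
  next
    case True
    then obtain S where S: "S \<in> stops 0" "risk S \<le> risk T" "AE \<omega> in M. ?\<tau> \<omega> \<le> S \<omega>"
      using unimprovable T by blast
    have "risk ?\<tau> \<le> risk S"
      unfolding risk_def
    \<comment> \<open>On \<open>level ?\<tau> n\<close> the value \<open>Y n\<close> is
      \<open>0\<close> and dominates the conditional gain of every continuation.\<close>
    proof (rule stopped_integral_le[OF \<tau> S(1,3) loss_measurable])
      fix n S' assume S': "S' \<in> stops n"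
      have "AE \<omega> in M. ereal_cond_exp M (F (enat n)) (gain n S') \<omega> \<le> Y n \<omega>"
        using Y[of n] S' by (auto simp: is_ess_sup_def)
      then show "(\<integral>\<^sup>+\<omega>\<in>level ?\<tau> n. loss n \<omega> \<partial>M) \<le> (\<integral>\<^sup>+\<omega>\<in>level ?\<tau> n. stopped loss S' \<omega> \<partial>M)"
        by (intro loss_le_if_cond_gain_nonpos[OF S' level_F[OF st]], eventually_elim)
          (auto simp: level_def dest: first_zero_eqD)
    qed
    then show ?thesis
      using S(2) by (rule order_trans)
  qed
qed

end

section \<open>The noisy cascade model\<close>

lemma (in noisy_cascade) subalgebra_signal_filtration: "subalgebra M (signal_filtration V M Q0 y t)"
proof -
  have "{y u s -` A \<inter> space M | u s A. u \<in> V \<and> enat s \<le> t \<and> A \<in> sets Q0} \<subseteq> sets M"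
    using signal by (auto intro: measurable_sets)
  then show ?thesis
    unfolding subalgebra_def signal_filtration_def
    by (simp add: space_measure_of_conv sets_measure_of_conv sets.sigma_sets_subset)
qed

lemma signal_filtration_mono:
  assumes "s \<le> t"
  shows "sets (signal_filtration V M S y s) \<subseteq> sets (signal_filtration V M S y t)"
  unfolding signal_filtration_def
  using assms by (auto simp: sets_measure_of_conv intro!: sigma_sets_mono' intro: order_trans)

text \<open>Essential suprema are determined only up to null sets, so optimality is claimed for
  every choice of measurable versions \<open>Y\<close>; the existence part keeps this from being
  vacuous.\<close>

theorem theorem1:
  fixes V :: "(real ^ 'k) set" and E :: "((real ^ 'k) \<times> (real ^ 'k)) set"
    and M :: "'w measure" and Q0 Q1 :: "'s measure"
    and v0 :: "'w \<Rightarrow> real ^ 'k" and y :: "real ^ 'k \<Rightarrow> nat \<Rightarrow> 'w \<Rightarrow> 's"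
    and F :: "enat \<Rightarrow> 'w measure" and vhat :: "nat \<Rightarrow> 'w \<Rightarrow> real ^ 'k"
    and gains :: "nat \<Rightarrow> ('w \<Rightarrow> ereal) set"
  assumes model: "noisy_cascade V E M Q0 Q1 v0 y"
    and finite_variance: "integrable M (\<lambda>\<omega>. (norm (v0 \<omega>))\<^sup>2)"
    and F_eq: "F = signal_filtration V M Q0 y"
    and vhat_eq: "vhat = (\<lambda>t. vec_cond_exp M (F (enat t)) v0)"
    and gains_eq: "gains =
      (\<lambda>s. {ereal_cond_exp M (F (enat s)) (stopping_gain V E vhat s T) | T. T \<in> stop_times M F s})"
  shows "(\<exists>Y. \<forall>s. is_ess_sup M (F (enat s)) (gains s) (Y s)) \<and>
    (\<forall>Y. (\<forall>s. is_ess_sup M (F (enat s)) (gains s) (Y s)) \<longrightarrow>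
      optimal V E M F v0 (first_zero Y) vhat)"
proof -
  interpret noisy_cascade V E M Q0 Q1 v0 y
    by (rule model)
  have v0_V: "v0 \<omega> \<in> V" if "\<omega> \<in> space M" for \<omega>
    using measurable_space[OF source that] by simp
  have v0_borel: "v0 \<in> borel_measurable M"
    using source by (rule measurable_compose) simp
  interpret S: stopped_estimation M F v0 "nbhd_size V E"
    unfolding F_eq
    by unfold_locales (rule subalgebra_signal_filtration signal_filtration_mono v0_borel
        finite_variance mono_nbhd_size nbhd_size_unbounded | assumption)+
  have vhat: "vhat = S.vhat"
    by (simp add: vhat_eq S.vhat_def[abs_def])
  have gain: "stopping_gain V E vhat s T = S.gain s T" for s T
    by (simp add: fun_eq_iff stopping_gain_def S.gain_def S.stopped_def vhat)
  \<comment> \<open>By vertex-transitivity the size of the ball around the random source depends on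
    its radius alone.\<close>
  have cost_eq: "cost V E M v0 T w =
      (\<integral>\<^sup>+\<omega>. (ennreal ((norm (v0 \<omega> - S.stopped w T \<omega>))\<^sup>2) + of_nat (nbhd_size V E (the_enat (T \<omega>)))) \<partial>M)" for T w
    unfolding cost_def
    by (intro nn_integral_cong)
      (simp add: card_nbhd_eq_nbhd_size v0_V S.stopped_def ennreal_plus ennreal_of_nat_eq_real_of_nat)
  have cost_vhat: "cost V E M v0 T vhat = S.risk T" for T
    unfolding cost_eq S.risk_def by (simp add: S.stopped_def[abs_def] S.loss_def S.sq_error_def vhat)
  \<comment> \<open>Pythagoras on the whole space: dropping the squared distance between
    \<open>w\<close> and the conditional mean leaves a smaller error.\<close>
  have risk_le: "S.risk T \<le> cost V E M v0 T w" if T: "T \<in> stop_times M F 0" and w: "w \<in> estimators F" for T w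
  proof -
    note st = S.stopsD(1)[OF T]
    have wF: "w n \<in> borel_measurable (F (enat n))" for n
      using w by (simp add: estimators_def)
    have wM: "w n \<in> borel_measurable M" for n
      using measurable_from_subalg[OF S.subalgebra_F wF] .
    have [measurable]: "T \<in> measurable M (count_space UNIV)" "S.stopped w T \<in> borel_measurable M"
      "S.stopped S.sq_error T \<in> borel_measurable M"
      by (intro S.stopping_time_measurable S.stopped_measurable st wM S.sq_error_measurable)+
    have "(\<integral>\<^sup>+\<omega>\<in>space M. ennreal ((norm (v0 \<omega> - S.stopped w T \<omega>))\<^sup>2) \<partial>M) \<ge>
        (\<integral>\<^sup>+\<omega>\<in>space M. S.stopped S.sq_error T \<omega> \<partial>M)"
    proof (subst S.stopped_pythagoras[OF T sets.top _ wF])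
      show "space M \<inter> S.level T n \<in> sets (F (enat n))" for n
        using S.level_F[OF st, of n] by (simp add: S.level_def Int_def conj_assoc[symmetric])
    qed simp
    moreover have "S.stopped S.loss T \<omega> = S.stopped S.sq_error T \<omega> + of_nat (nbhd_size V E (the_enat (T \<omega>)))" for \<omega>
      by (simp add: S.stopped_def S.loss_def)
    ultimately show ?thesis
      unfolding cost_eq S.risk_def
      by (simp add: nn_integral_add nn_set_integral_space add_right_mono cong: nn_integral_cong_simp)
  qed
  have "\<exists>Y. is_ess_sup M (F (enat s)) (gains s) Y" for s
    by (intro is_ess_sup_exists prob_space_axioms S.subalgebra_F)
      (auto simp: gains_eq borel_measurable_ereal_cond_exp)
  then have "\<exists>Y. \<forall>s. is_ess_sup M (F (enat s)) (gains s) (Y s)"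
    by metis
  moreover have "optimal V E M F v0 (first_zero Y) vhat"
    if "\<forall>s. is_ess_sup M (F (enat s)) (gains s) (Y s)" for Y
  proof -
    note opt = S.first_zero_optimal[of Y]
    have Y: "is_ess_sup M (F (enat s))
        {ereal_cond_exp M (F (enat s)) (S.gain s T) | T. T \<in> stop_times M F s} (Y s)" for s
      using that by (simp add: gains_eq gain)
    show ?thesis
      unfolding optimal_def cost_vhat
      using opt[OF Y] risk_le S.vhat_measurable_F by (auto simp: estimators_def vhat intro: order_trans)
  qed
  ultimately show ?thesis
    by blast
qed

end
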